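(* Let $X$ be a zero-dimensional metric space with derived set $X'$. Then $C_k(X,2)$ is sequential if and only if $X$ is a Polish space and one of the following conditions holds: (a) $X$ is not locally compact but $X'$ is compact; (b) $X$ is locally compact. Moreover, (for $X$ Polish) in case (a), $C_k(X,2)$ has an open subgroup $H$ which is topologically isomorphic to $(2^\omega)^\infty$, and $C_k(X,2)$ is homeomorphic to $(2^\omega)^\infty$; and in case (b), $C_k(X,2)$ is a Polish space.
   Context: Zero-dimensional means having a base of clopen sets. The derived set $X'$ is the set of all non-isolated points of $X$. $2=\{0,1\}=\mathbb{Z}(2)$ is the two-element discrete group, and $2^\omega$ is the compact group $\mathbb{Z}(2)^\omega$ with the product topology. $C_k(X,2)$ is the set of continuous functions $X\to 2$ with the compact-open topology, a topological abelian group under pointwise operations. A space $Z$ is sequential if for each non-closed $A\subset Z$ there is a sequence in $A$ converging to some point of $\overline{A}\setminus A$. For a topological group $G$, $G^\infty$ denotes the direct sum $\bigoplus_{n\in\mathbb{N}}G_n$ with $G_n=G$ for all $n$ (the subgroup of $\prod_n G_n$ of all $(g_n)$ with $g_n=e$ for all but finitely many $n$), endowed with the box topology, i.e. the group topology with neighborhood base at the identity given by the sets $\big(\prod_n U_n\big)\cap\bigoplus_n G_n$, $U_n$ an open neighborhood of the identity of $G_n$. *)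

theory Defs
  imports "HOL-Analysis.Analysis" "HOL-Algebra.Product_Groups" "HOL-Algebra.Elementary_Groups"
begin

definition zero_dimensional_space :: "'a topology \<Rightarrow> bool" where
  "zero_dimensional_space X \<longleftrightarrow>
     (\<exists>\<B>. (\<forall>V\<in>\<B>. openin X V \<and> closedin X V) \<and>
          (\<forall>U x. openin X U \<and> x \<in> U \<longrightarrow> (\<exists>V\<in>\<B>. x \<in> V \<and> V \<subseteq> U)))"

definition Polish_space :: "'a topology \<Rightarrow> bool" where
  "Polish_space X \<longleftrightarrow> separable_space X \<and> completely_metrizable_space X"

definition sequential_space :: "'a topology \<Rightarrow> bool" where
  "sequential_space Z \<longleftrightarrow>
     (\<forall>A \<subseteq> topspace Z. \<not> closedin Z A \<longrightarrow>
        (\<exists>\<sigma> l. range \<sigma> \<subseteq> A \<and> l \<in> Z closure_of A - A \<and> limitin Z \<sigma> l sequentially))"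

text \<open>Functions on a carrier are represented extensionally, as in the product topology and in
  \<^const>\<open>product_group\<close>.\<close>

definition continuous_functions :: "'a topology \<Rightarrow> 'b topology \<Rightarrow> ('a \<Rightarrow> 'b) set" where
  "continuous_functions X Y = {f \<in> extensional (topspace X). continuous_map X Y f}"

definition compact_open_topology :: "'a topology \<Rightarrow> 'b topology \<Rightarrow> ('a \<Rightarrow> 'b) topology" where
  "compact_open_topology X Y =
     topology_generated_by
       {{f \<in> continuous_functions X Y. f ` K \<subseteq> U} |K U. compactin X K \<and> openin Y U}"

lemma topspace_compact_open_topology [simp]:
  "topspace (compact_open_topology X Y) = continuous_functions X Y"
proof -
  have "continuous_functions X Y = {f \<in> continuous_functions X Y. f ` {} \<subseteq> {}}"
    by simp
  then show ?thesis
    unfolding compact_open_topology_def topology_generated_by_topspace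
    using compactin_empty[of X] openin_empty[of Y] by blast
qed

definition continuous_function_group ::
    "'a topology \<Rightarrow> 'b topology \<Rightarrow> ('b, 'c) monoid_scheme \<Rightarrow> ('a \<Rightarrow> 'b) monoid" where
  "continuous_function_group X T G =
     product_group (topspace X) (\<lambda>_. G) \<lparr>carrier := continuous_functions X T\<rparr>"

definition topologically_isomorphic ::
    "('a, 'c) monoid_scheme \<Rightarrow> 'a topology \<Rightarrow> ('b, 'd) monoid_scheme \<Rightarrow> 'b topology \<Rightarrow> bool" where
  "topologically_isomorphic G S H T \<longleftrightarrow> (\<exists>h. h \<in> iso G H \<and> homeomorphic_map S T h)"

text \<open>The group \<open>G\<^sup>\<infinity>\<close>, and on it the group topology having the boxes around the identity as a
  neighbourhood base at the identity.\<close>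

definition direct_power :: "('a, 'c) monoid_scheme \<Rightarrow> (nat \<Rightarrow> 'a) monoid" where
  "direct_power G = sum_group UNIV (\<lambda>_. G)"

definition box_nhd :: "('a, 'c) monoid_scheme \<Rightarrow> (nat \<Rightarrow> 'a set) \<Rightarrow> (nat \<Rightarrow> 'a) set" where
  "box_nhd G U = (\<Pi>\<^sub>E n\<in>UNIV. U n) \<inter> carrier (direct_power G)"

definition direct_power_topology ::
    "('a, 'c) monoid_scheme \<Rightarrow> 'a topology \<Rightarrow> (nat \<Rightarrow> 'a) topology" where
  "direct_power_topology G T =
     topology (\<lambda>W. W \<subseteq> carrier (direct_power G) \<and>
       (\<forall>x\<in>W. \<exists>U. (\<forall>n. openin T (U n) \<and> \<one>\<^bsub>G\<^esub> \<in> U n) \<and>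
                  x <#\<^bsub>direct_power G\<^esub> box_nhd G U \<subseteq> W))"

lemma l_coset_mono: "A \<subseteq> B \<Longrightarrow> x <#\<^bsub>G\<^esub> A \<subseteq> x <#\<^bsub>G\<^esub> B"
  by (auto simp: l_coset_def)

lemma istopology_direct_power:
  "istopology (\<lambda>W. W \<subseteq> carrier (direct_power G) \<and>
       (\<forall>x\<in>W. \<exists>U. (\<forall>n. openin T (U n) \<and> \<one>\<^bsub>G\<^esub> \<in> U n) \<and>
                  x <#\<^bsub>direct_power G\<^esub> box_nhd G U \<subseteq> W))"
  (is "istopology (\<lambda>W. _ \<and> ?P W)")
  unfolding istopology_def
proof (intro conjI allI impI)
  fix S V
  assume S: "S \<subseteq> carrier (direct_power G) \<and> ?P S" and V: "V \<subseteq> carrier (direct_power G) \<and> ?P V"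
  then show "S \<inter> V \<subseteq> carrier (direct_power G)" by blast
  show "?P (S \<inter> V)"
  proof
    fix x assume x: "x \<in> S \<inter> V"
    obtain A where A: "\<And>n. openin T (A n) \<and> \<one>\<^bsub>G\<^esub> \<in> A n" "x <#\<^bsub>direct_power G\<^esub> box_nhd G A \<subseteq> S"
      using S x by blast
    obtain B where B: "\<And>n. openin T (B n) \<and> \<one>\<^bsub>G\<^esub> \<in> B n" "x <#\<^bsub>direct_power G\<^esub> box_nhd G B \<subseteq> V"
      using V x by blast
    have "box_nhd G (\<lambda>n. A n \<inter> B n) \<subseteq> box_nhd G A" "box_nhd G (\<lambda>n. A n \<inter> B n) \<subseteq> box_nhd G B"
      by (auto simp: box_nhd_def)
    then have "x <#\<^bsub>direct_power G\<^esub> box_nhd G (\<lambda>n. A n \<inter> B n) \<subseteq> S \<inter> V"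
      by (intro Int_greatest subset_trans[OF l_coset_mono A(2)] subset_trans[OF l_coset_mono B(2)])
    then show "\<exists>U. (\<forall>n. openin T (U n) \<and> \<one>\<^bsub>G\<^esub> \<in> U n) \<and> x <#\<^bsub>direct_power G\<^esub> box_nhd G U \<subseteq> S \<inter> V"
      using A(1) B(1) by (intro exI[of _ "\<lambda>n. A n \<inter> B n"]) auto
  qed
next
  fix \<K> assume *: "\<forall>W\<in>\<K>. W \<subseteq> carrier (direct_power G) \<and> ?P W"
  then show "\<Union>\<K> \<subseteq> carrier (direct_power G)" by blast
  show "?P (\<Union>\<K>)"
  proof
    fix x assume "x \<in> \<Union>\<K>"
    then obtain W where W: "W \<in> \<K>" "x \<in> W" by blast
    with * obtain U where "\<forall>n. openin T (U n) \<and> \<one>\<^bsub>G\<^esub> \<in> U n"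
        "x <#\<^bsub>direct_power G\<^esub> box_nhd G U \<subseteq> W"
      by blast
    with W show "\<exists>U. (\<forall>n. openin T (U n) \<and> \<one>\<^bsub>G\<^esub> \<in> U n) \<and> x <#\<^bsub>direct_power G\<^esub> box_nhd G U \<subseteq> \<Union>\<K>"
      by (intro exI[of _ U]) blast
  qed
qed

lemma openin_direct_power_topology:
  "openin (direct_power_topology G T) W \<longleftrightarrow>
     W \<subseteq> carrier (direct_power G) \<and>
     (\<forall>x\<in>W. \<exists>U. (\<forall>n. openin T (U n) \<and> \<one>\<^bsub>G\<^esub> \<in> U n) \<and>
                x <#\<^bsub>direct_power G\<^esub> box_nhd G U \<subseteq> W)"
  unfolding direct_power_topology_def by (simp only: topology_inverse'[OF istopology_direct_power])

lemma carrier_direct_power: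
  assumes "group G"
  shows "carrier (direct_power G) = {x. (\<forall>n. x n \<in> carrier G) \<and> finite {n. x n \<noteq> \<one>\<^bsub>G\<^esub>}}"
  using assms by (auto simp: direct_power_def carrier_sum_group)

lemma mult_direct_power: "x \<otimes>\<^bsub>direct_power G\<^esub> y = (\<lambda>n. x n \<otimes>\<^bsub>G\<^esub> y n)"
  by (simp add: direct_power_def sum_group_def restrict_def)

lemma direct_power_topology_eq_box_topology:
  assumes "group G" and T: "topspace T = carrier G"
    and cont: "\<And>a. a \<in> carrier G \<Longrightarrow> continuous_map T T (\<lambda>g. a \<otimes>\<^bsub>G\<^esub> g)"
  shows "direct_power_topology G T =
    topology_generated_by {box_nhd G U |U. \<forall>n. openin T (U n)}" (is "?L = ?R")
proof -
  interpret group G by fact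
  note carr = carrier_direct_power[OF \<open>group G\<close>]
  have closed: "(\<lambda>n. x n \<otimes>\<^bsub>G\<^esub> y n) \<in> carrier (direct_power G)"
    if "x \<in> carrier (direct_power G)" "y \<in> carrier (direct_power G)" for x y
  proof -
    have "{n. x n \<otimes>\<^bsub>G\<^esub> y n \<noteq> \<one>\<^bsub>G\<^esub>} \<subseteq> {n. x n \<noteq> \<one>\<^bsub>G\<^esub>} \<union> {n. y n \<noteq> \<one>\<^bsub>G\<^esub>}"
      by auto
    with that show ?thesis
      unfolding carr by (auto intro: finite_subset)
  qed
  have trans: "openin T {g \<in> carrier G. a \<otimes>\<^bsub>G\<^esub> g \<in> U}" if "a \<in> carrier G" "openin T U" for a U
    using cont[OF that(1)] that(2) openin_continuous_map_preimage[of T T _ U] T by force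
  have gen: "openin ?L (box_nhd G U)" if U: "\<And>n. openin T (U n)" for U
    unfolding openin_direct_power_topology
  proof (intro conjI ballI)
    show "box_nhd G U \<subseteq> carrier (direct_power G)" by (auto simp: box_nhd_def)
    fix x assume x: "x \<in> box_nhd G U"
    then have xc: "x \<in> carrier (direct_power G)" and xU: "\<And>n. x n \<in> U n"
      by (auto simp: box_nhd_def)
    define V where "V n = {g \<in> carrier G. x n \<otimes>\<^bsub>G\<^esub> g \<in> U n}" for n
    have "openin T (V n) \<and> \<one>\<^bsub>G\<^esub> \<in> V n" for n
      using trans[of "x n" "U n"] U xU xc by (auto simp: V_def carr)
    moreover have "x <#\<^bsub>direct_power G\<^esub> box_nhd G V \<subseteq> box_nhd G U"
      using closed[OF xc] by (auto simp: l_coset_def box_nhd_def mult_direct_power V_def PiE_iff)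
    ultimately show "\<exists>V. (\<forall>n. openin T (V n) \<and> \<one>\<^bsub>G\<^esub> \<in> V n) \<and>
        x <#\<^bsub>direct_power G\<^esub> box_nhd G V \<subseteq> box_nhd G U"
      by blast
  qed
  have 1: "openin ?L W" if "openin ?R W" for W
  proof (rule generate_topology_on_coarsest)
    show "generate_topology_on {box_nhd G U |U. \<forall>n. openin T (U n)} W"
      using that by (simp add: openin_topology_generated_by_iff)
  qed (use gen in auto)
  have 2: "openin ?R W" if W: "openin ?L W" for W
  proof (subst openin_subopen, intro ballI)
    fix x assume x: "x \<in> W"
    with W obtain V where V: "\<And>n. openin T (V n) \<and> \<one>\<^bsub>G\<^esub> \<in> V n"
        "x <#\<^bsub>direct_power G\<^esub> box_nhd G V \<subseteq> W"
      unfolding openin_direct_power_topology by blast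
    have xc: "x \<in> carrier (direct_power G)"
      using W x unfolding openin_direct_power_topology by blast
    then have xG: "x n \<in> carrier G" for n by (auto simp: carr)
    define U where "U n = {g \<in> carrier G. inv\<^bsub>G\<^esub> x n \<otimes>\<^bsub>G\<^esub> g \<in> V n}" for n
    have "openin ?R (box_nhd G U)"
      by (intro topology_generated_by_Basis) (use trans V xG in \<open>auto simp: U_def\<close>)
    moreover have "x \<in> box_nhd G U"
      using xc xG V by (auto simp: box_nhd_def U_def)
    moreover have "box_nhd G U \<subseteq> W"
    proof
      fix y assume y: "y \<in> box_nhd G U"
      then have yc: "y \<in> carrier (direct_power G)" and yU: "\<And>n. y n \<in> U n"
        by (auto simp: box_nhd_def)
      let ?z = "\<lambda>n. inv\<^bsub>G\<^esub> x n \<otimes>\<^bsub>G\<^esub> y n"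
      have "(\<lambda>n. inv\<^bsub>G\<^esub> x n) \<in> carrier (direct_power G)"
      proof -
        have "{n. inv\<^bsub>G\<^esub> x n \<noteq> \<one>\<^bsub>G\<^esub>} \<subseteq> {n. x n \<noteq> \<one>\<^bsub>G\<^esub>}" by auto
        then show ?thesis using xc unfolding carr by (auto intro: finite_subset)
      qed
      then have "?z \<in> box_nhd G V"
        using closed[OF _ yc] yU by (auto simp: box_nhd_def U_def)
      moreover have "y = x \<otimes>\<^bsub>direct_power G\<^esub> ?z"
        using xG yc by (auto simp: mult_direct_power carr m_assoc[symmetric])
      ultimately show "y \<in> W"
        using V(2) by (auto simp: l_coset_def)
    qed
    ultimately show "\<exists>S. openin ?R S \<and> x \<in> S \<and> S \<subseteq> W" by blast
  qed
  show ?thesis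
    using 1 2 by (auto simp: topology_eq)
qed

abbreviation Z2 :: "int monoid" where
  "Z2 \<equiv> integer_mod_group 2"

abbreviation Z2_topology :: "int topology" where
  "Z2_topology \<equiv> discrete_topology (carrier Z2)"

abbreviation Ck2 :: "'a topology \<Rightarrow> ('a \<Rightarrow> int) topology" where
  "Ck2 X \<equiv> compact_open_topology X Z2_topology"

abbreviation Ck2_group :: "'a topology \<Rightarrow> ('a \<Rightarrow> int) monoid" where
  "Ck2_group X \<equiv> continuous_function_group X Z2_topology Z2"

abbreviation Cantor_group :: "(nat \<Rightarrow> int) monoid" where
  "Cantor_group \<equiv> product_group UNIV (\<lambda>_. Z2)"

abbreviation Cantor_topology :: "(nat \<Rightarrow> int) topology" where
  "Cantor_topology \<equiv> product_topology (\<lambda>_. Z2_topology) UNIV"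

lemma group_Ck2_group: "group (Ck2_group X)"
proof -
  let ?P = "product_group (topspace X) (\<lambda>_. Z2)"
  let ?C = "continuous_functions X Z2_topology"
  have P: "group ?P" by simp
  have ext: "(\<lambda>x\<in>topspace X. h (f x) (g x)) \<in> ?C"
    if f: "f \<in> ?C" and g: "g \<in> ?C"
      and h: "\<And>a b. a \<in> carrier Z2 \<Longrightarrow> b \<in> carrier Z2 \<Longrightarrow> h a b \<in> carrier Z2" for f g h
  proof -
    have "continuous_map X (prod_topology Z2_topology Z2_topology) (\<lambda>x. (f x, g x))"
      using f g by (simp add: continuous_map_pairedI continuous_functions_def)
    moreover have "continuous_map (prod_topology Z2_topology Z2_topology) Z2_topology (\<lambda>(a, b). h a b)"
      unfolding prod_topology_discrete_topology[symmetric] using h by auto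
    ultimately have "continuous_map X Z2_topology ((\<lambda>(a, b). h a b) \<circ> (\<lambda>x. (f x, g x)))"
      by (rule continuous_map_compose)
    then have "continuous_map X Z2_topology (\<lambda>x\<in>topspace X. h (f x) (g x))"
      by (rule continuous_map_eq) simp
    then show ?thesis by (simp add: continuous_functions_def)
  qed
  have sub: "?C \<subseteq> carrier ?P"
  proof
    fix f assume "f \<in> ?C"
    then have "f \<in> extensional (topspace X)" "f \<in> topspace X \<rightarrow> topspace Z2_topology"
      unfolding continuous_functions_def continuous_map_def by blast+
    then show "f \<in> carrier ?P" by (simp add: PiE_def)
  qed
  have "subgroup ?C ?P"
  proof (rule group.subgroupI[OF P])
    show "?C \<subseteq> carrier ?P" by (rule sub)
    have "(\<lambda>x\<in>topspace X. 0) \<in> ?C"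
      using continuous_map_eq[of X Z2_topology "\<lambda>_. 0" "\<lambda>x\<in>topspace X. 0"]
      by (simp add: continuous_functions_def carrier_integer_mod_group)
    then show "?C \<noteq> {}" by blast
  next
    fix f assume f: "f \<in> ?C"
    have "inv\<^bsub>?P\<^esub> f = (\<lambda>x\<in>topspace X. inv\<^bsub>Z2\<^esub> f x)"
      using sub f by (intro inv_product_group) auto
    also have "\<dots> \<in> ?C"
      by (rule ext[OF f f]) (rule group.inv_closed[OF group_integer_mod_group])
    finally show "inv\<^bsub>?P\<^esub> f \<in> ?C" .
  next
    fix f g assume "f \<in> ?C" "g \<in> ?C"
    then have "(\<lambda>x\<in>topspace X. f x \<otimes>\<^bsub>Z2\<^esub> g x) \<in> ?C"
      by (rule ext) (rule monoid.m_closed[OF group.is_monoid[OF group_integer_mod_group]])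
    then show "f \<otimes>\<^bsub>?P\<^esub> g \<in> ?C" by (simp add: product_group_def)
  qed
  then show ?thesis
    unfolding continuous_function_group_def by (rule subgroup.subgroup_is_group[OF _ P])
qed

end

theory Submission
  imports Defs "HOL-Library.Diagonal_Subsequence"
begin

text \<open>Convergence in \<open>C\<^sub>k(X,2)\<close> is eventual agreement on each compact set. Countable tightness of a
  sequential \<open>C\<^sub>k(X,2)\<close> makes \<open>X\<close> Lindelof. If the derived set \<open>X'\<close> is not compact and \<open>X\<close> is
  not locally compact at \<open>p\<close>, then a closed discrete sequence in \<open>X'\<close> and closed discrete
  sequences in the balls around \<open>p\<close> yield a sequentially closed set of functions that does
  not contain the zero function but has it in its closure.

  If \<open>X\<close> is locally compact and Polish, then it is a countable sum of compact clopen sets, so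
  \<open>C\<^sub>k(X,2)\<close> is a countable product of countable discrete spaces. If \<open>X'\<close> is compact and \<open>X\<close> is
  not locally compact, then the isolated points split into infinite closed discrete levels that
  shrink to \<open>X'\<close>. A function vanishing on \<open>X'\<close> vanishes on almost all levels, and a compact set
  meets each level in a finite but otherwise arbitrary set; hence these functions form an open
  subgroup isomorphic to \<open>(2\<^sup>\<omega>)\<^sup>\<infinity>\<close>. It has countably many cosets, and \<open>(2\<^sup>\<omega>)\<^sup>\<infinity>\<close> is
  itself a countably infinite sum of copies of itself.\<close>

section \<open>The compact-open topology on functions into the two-point group\<close>

text \<open>Sequentiality rests instead on two facts: continuous functions that are equal on
  \<open>X'\<close> are equal on almost all levels, which ends an infinite choice of numbers
  \<open>k n\<close>; and there are only two values per point, so that a failure at one level yields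
  a convergent subsequence. The same functions \<open>k\<close> describe boxes in
  (2^omega)^infinity, by prescribing the first \<open>k n\<close> bits in factor \<open>n\<close>.
  This is where the box topology comes from, whereas the direct sum reflects agreement on almost all
  levels. In the direction from sequentiality, Polishness of \<open>X\<close> has to be extracted:
  separability comes from the Lindelof property, complete metrizability from local compactness or
  from compactness of \<open>X'\<close>.\<close>

lemma carrier_Z2: "carrier Z2 = {0, 1}"
  by (auto simp: carrier_integer_mod_group)

lemma continuous_functions_Z2_iff:
  "f \<in> continuous_functions X Z2_topology \<longleftrightarrow>
     f \<in> extensional (topspace X) \<and> f \<in> topspace X \<rightarrow> {0, 1} \<and>
     openin X {x \<in> topspace X. f x = 0} \<and> openin X {x \<in> topspace X. f x = 1}"
proof -
  have eq: "continuous_map X Z2_topology f \<longleftrightarrow> f \<in> topspace X \<rightarrow> {0, 1} \<and>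
      (\<forall>U. U \<subseteq> {0, 1} \<longrightarrow> openin X {x \<in> topspace X. f x \<in> U})"
    unfolding continuous_map_def openin_discrete_topology topspace_discrete_topology carrier_Z2 ..
  have "(\<forall>U. U \<subseteq> {0, 1} \<longrightarrow> openin X {x \<in> topspace X. f x \<in> U}) \<longleftrightarrow>
      openin X {x \<in> topspace X. f x = 0} \<and> openin X {x \<in> topspace X. f x = 1}" (is "?L \<longleftrightarrow> ?R")
  proof
    assume L: ?L
    show ?R
      using L[rule_format, of "{0}"] L[rule_format, of "{1}"] by simp
  next
    assume R: ?R
    show ?L
    proof (intro allI impI)
      fix U :: "int set" assume "U \<subseteq> {0, 1}"
      then have "{x \<in> topspace X. f x \<in> U} =
          (if 0 \<in> U then {x \<in> topspace X. f x = 0} else {}) \<union>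
          (if 1 \<in> U then {x \<in> topspace X. f x = 1} else {})"
        by auto
      moreover have "openin X \<dots>"
        using R by (intro openin_Un) (simp_all split: if_split)
      ultimately show "openin X {x \<in> topspace X. f x \<in> U}" by simp
    qed
  qed
  then show ?thesis
    by (simp only: continuous_functions_def mem_Collect_eq eq)
qed

lemma continuous_functions_Z2_values:
  assumes "f \<in> continuous_functions X Z2_topology" "x \<in> topspace X"
  shows "f x = 0 \<or> f x = 1"
  using assms by (auto simp: continuous_functions_Z2_iff)

lemma continuous_functions_Z2_eqI:
  assumes "f \<in> continuous_functions X Z2_topology" "g \<in> continuous_functions X Z2_topology"
    and "\<And>x. x \<in> topspace X \<Longrightarrow> f x = g x"
  shows "f = g"
  using assms by (auto simp: continuous_functions_Z2_iff intro: extensionalityI)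

lemma continuous_functions_Z2_nhd:
  assumes "f \<in> continuous_functions X Z2_topology" "x \<in> topspace X"
  shows "openin X {y \<in> topspace X. f y = f x}"
  using assms by (auto simp: continuous_functions_Z2_iff Pi_iff)

lemma continuous_functions_Z2_closedin:
  assumes "f \<in> continuous_functions X Z2_topology"
  shows "closedin X {x \<in> topspace X. f x = c}"
proof -
  have "topspace X - {x \<in> topspace X. f x = c} =
      (if c = 0 then {} else {x \<in> topspace X. f x = 0}) \<union>
      (if c = 1 then {} else {x \<in> topspace X. f x = 1})"
    using assms by (auto simp: continuous_functions_Z2_iff)
  then show ?thesis
    using assms by (simp add: closedin_def openin_Un continuous_functions_Z2_iff)
qed

definition clopen_char :: "'a topology \<Rightarrow> 'a set \<Rightarrow> 'a \<Rightarrow> int" where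
  "clopen_char X U = (\<lambda>x\<in>topspace X. if x \<in> U then 1 else 0)"

lemma clopen_char_in:
  assumes "openin X U" "closedin X U"
  shows "clopen_char X U \<in> continuous_functions X Z2_topology"
proof -
  have "{x \<in> topspace X. clopen_char X U x = 0} = topspace X - U"
    "{x \<in> topspace X. clopen_char X U x = 1} = U"
    using openin_subset[OF assms(1)] by (auto simp: clopen_char_def)
  then show ?thesis
    using assms by (auto simp: continuous_functions_Z2_iff clopen_char_def)
qed

lemma clopen_char_apply [simp]:
  "x \<in> topspace X \<Longrightarrow> clopen_char X U x = (if x \<in> U then 1 else 0)"
  by (simp add: clopen_char_def)

text \<open>As \<open>f\<close> has only two values, it splits \<open>K\<close> into two compact
  pieces on which it is constant. Agreement with \<open>f\<close> on \<open>K\<close> is the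
  intersection of the two corresponding subbasic conditions.\<close>

lemma openin_Ck2_agree:
  assumes K: "compactin X K" and f: "f \<in> continuous_functions X Z2_topology"
  shows "openin (Ck2 X) {g \<in> continuous_functions X Z2_topology. \<forall>x\<in>K. g x = f x}"
proof -
  let ?B = "\<lambda>c. {g \<in> continuous_functions X Z2_topology. g ` (K \<inter> {x \<in> topspace X. f x = c}) \<subseteq> {c}}"
  have *: "openin (Ck2 X) (?B c)" if "c \<in> {0, 1}" for c
    unfolding compact_open_topology_def
  proof (rule topology_generated_by_Basis, rule CollectI, intro exI conjI)
    show "compactin X (K \<inter> {x \<in> topspace X. f x = c})"
      using K continuous_functions_Z2_closedin[OF f] by (rule compact_Int_closedin)
    show "openin Z2_topology {c}" using that by (simp add: carrier_Z2)
  qed auto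
  have "x \<in> topspace X \<and> (f x = 0 \<or> f x = 1)" if "x \<in> K" for x
    using compactin_subset_topspace[OF K] continuous_functions_Z2_values[OF f] that by blast
  note K01 = this
  have "(\<forall>x\<in>K. g x = f x) \<longleftrightarrow>
      g ` (K \<inter> {x \<in> topspace X. f x = 0}) \<subseteq> {0} \<and> g ` (K \<inter> {x \<in> topspace X. f x = 1}) \<subseteq> {1}"
    (is "?l \<longleftrightarrow> ?r") for g
  proof
    assume R: ?r
    show ?l
    proof
      fix x assume x: "x \<in> K"
      with K01[OF x] R show "g x = f x" unfolding image_subset_iff by fastforce
    qed
  qed auto
  then have "{g \<in> continuous_functions X Z2_topology. \<forall>x\<in>K. g x = f x} = ?B 0 \<inter> ?B 1"
    by (simp only: set_eq_iff mem_Collect_eq Int_iff) blast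
  then show ?thesis using *[of 0] *[of 1] by (simp only: openin_Int insertI1 insertI2 simp_thms)
qed

text \<open>Uniform convergence on compact sets is agreement, because the values are discrete.\<close>

lemma openin_Ck2:
  "openin (Ck2 X) W \<longleftrightarrow>
     W \<subseteq> continuous_functions X Z2_topology \<and>
     (\<forall>f\<in>W. \<exists>K. compactin X K \<and>
        {g \<in> continuous_functions X Z2_topology. \<forall>x\<in>K. g x = f x} \<subseteq> W)"
  (is "?L \<longleftrightarrow> _ \<and> ?R W")
proof
  assume L: ?L
  then have "generate_topology_on
      {{f \<in> continuous_functions X Z2_topology. f ` K \<subseteq> U} |K U. compactin X K \<and> openin Z2_topology U} W"
    by (simp add: compact_open_topology_def openin_topology_generated_by_iff)
  then have "?R W"
  proof induction
    case (Int A B)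
    show ?case
    proof
      fix f assume "f \<in> A \<inter> B"
      with Int.IH obtain K K' where "compactin X K" "compactin X K'"
        "{g \<in> continuous_functions X Z2_topology. \<forall>x\<in>K. g x = f x} \<subseteq> A"
        "{g \<in> continuous_functions X Z2_topology. \<forall>x\<in>K'. g x = f x} \<subseteq> B" by blast
      then show "\<exists>K. compactin X K \<and>
          {g \<in> continuous_functions X Z2_topology. \<forall>x\<in>K. g x = f x} \<subseteq> A \<inter> B"
        by (intro exI[of _ "K \<union> K'"]) (auto intro: compactin_Un)
    qed
  next
    case (UN \<K>)
    then show ?case by (meson Union_iff Union_upper subset_trans)
  next
    case (Basis S)
    then obtain K U where S: "S = {f \<in> continuous_functions X Z2_topology. f ` K \<subseteq> U}"
      and "compactin X K" by blast
    then show ?case by (intro ballI exI[of _ K]) (force simp: S)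
  qed simp
  moreover have "W \<subseteq> continuous_functions X Z2_topology"
    using openin_subset[OF L] by simp
  ultimately show "W \<subseteq> continuous_functions X Z2_topology \<and> ?R W" by blast
next
  assume R: "W \<subseteq> continuous_functions X Z2_topology \<and> ?R W"
  show ?L
  proof (subst openin_subopen, intro ballI)
    fix f assume f: "f \<in> W"
    then obtain K where "compactin X K" 
      "{g \<in> continuous_functions X Z2_topology. \<forall>x\<in>K. g x = f x} \<subseteq> W"
      using R by blast
    moreover have "f \<in> continuous_functions X Z2_topology" using f R by blast
    ultimately show "\<exists>T. openin (Ck2 X) T \<and> f \<in> T \<and> T \<subseteq> W"
      by (intro exI[of _ "{g \<in> continuous_functions X Z2_topology. \<forall>x\<in>K. g x = f x}"])
        (auto intro: openin_Ck2_agree)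
  qed
qed

lemma openin_Ck2E:
  assumes "openin (Ck2 X) W" "f \<in> W"
  obtains K where "compactin X K"
    "{g \<in> continuous_functions X Z2_topology. \<forall>x\<in>K. g x = f x} \<subseteq> W"
  using assms unfolding openin_Ck2 by blast

lemma limitin_Ck2:
  "limitin (Ck2 X) \<sigma> l F \<longleftrightarrow>
     l \<in> continuous_functions X Z2_topology \<and>
     (\<forall>K. compactin X K \<longrightarrow>
        (\<forall>\<^sub>F i in F. \<sigma> i \<in> continuous_functions X Z2_topology \<and> (\<forall>x\<in>K. \<sigma> i x = l x)))"
proof (intro iffI conjI allI impI)
  assume L: "limitin (Ck2 X) \<sigma> l F"
  show l: "l \<in> continuous_functions X Z2_topology"
    using limitin_topspace[OF L] by simp
  fix K assume "compactin X K"
  from openin_Ck2_agree[OF this l] L l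
  show "\<forall>\<^sub>F i in F. \<sigma> i \<in> continuous_functions X Z2_topology \<and> (\<forall>x\<in>K. \<sigma> i x = l x)"
    unfolding limitin_def by force
next
  assume R: "l \<in> continuous_functions X Z2_topology \<and>
     (\<forall>K. compactin X K \<longrightarrow>
        (\<forall>\<^sub>F i in F. \<sigma> i \<in> continuous_functions X Z2_topology \<and> (\<forall>x\<in>K. \<sigma> i x = l x)))"
  show "limitin (Ck2 X) \<sigma> l F"
    unfolding limitin_def
  proof (intro conjI allI impI)
    fix W assume "openin (Ck2 X) W \<and> l \<in> W"
    then obtain K where K: "compactin X K" 
      "{g \<in> continuous_functions X Z2_topology. \<forall>x\<in>K. g x = l x} \<subseteq> W"
      by (elim conjE openin_Ck2E)
    with R have "\<forall>\<^sub>F i in F. \<sigma> i \<in> continuous_functions X Z2_topology \<and> (\<forall>x\<in>K. \<sigma> i x = l x)"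
      by blast
    then show "\<forall>\<^sub>F i in F. \<sigma> i \<in> W"
      by eventually_elim (use K in blast)
  qed (use R in simp)
qed

lemma in_Ck2_closure_of:
  assumes "A \<subseteq> continuous_functions X Z2_topology"
  shows "f \<in> Ck2 X closure_of A \<longleftrightarrow>
     f \<in> continuous_functions X Z2_topology \<and>
     (\<forall>K. compactin X K \<longrightarrow> (\<exists>g\<in>A. \<forall>x\<in>K. g x = f x))" (is "?L \<longleftrightarrow> ?R")
proof
  assume L: ?L
  then have f: "f \<in> continuous_functions X Z2_topology"
    by (simp add: in_closure_of)
  have "\<exists>g\<in>A. \<forall>x\<in>K. g x = f x" if K: "compactin X K" for K
  proof -
    have "f \<in> {g \<in> continuous_functions X Z2_topology. \<forall>x\<in>K. g x = f x}"
      using f by simp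
    with L openin_Ck2_agree[OF K f] obtain g
      where "g \<in> A" "g \<in> {g \<in> continuous_functions X Z2_topology. \<forall>x\<in>K. g x = f x}"
      unfolding in_closure_of by meson
    then show ?thesis by blast
  qed
  with f show ?R by blast
next
  assume R: ?R
  show ?L
    unfolding in_closure_of
  proof (intro conjI allI impI)
    fix W assume "f \<in> W \<and> openin (Ck2 X) W"
    then obtain K where "compactin X K" 
      "{g \<in> continuous_functions X Z2_topology. \<forall>x\<in>K. g x = f x} \<subseteq> W"
      by (elim conjE openin_Ck2E)
    then show "\<exists>y. y \<in> A \<and> y \<in> W" using R assms by blast
  qed (use R in simp)
qed

section \<open>Sequential spaces\<close>

lemma sequential_space_iff:
  "sequential_space Z \<longleftrightarrow>
     (\<forall>A \<subseteq> topspace Z. (\<forall>\<sigma> l. range \<sigma> \<subseteq> A \<and> limitin Z \<sigma> l sequentially \<longrightarrow> l \<in> A) \<longrightarrow> closedin Z A)"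
proof -
  have "l \<in> Z closure_of A"
    if "range \<sigma> \<subseteq> A" "limitin Z \<sigma> l sequentially" for A \<sigma> l
    unfolding in_closure_of
  proof (intro conjI allI impI)
    fix T assume "l \<in> T \<and> openin Z T"
    then have "\<forall>\<^sub>F i in sequentially. \<sigma> i \<in> T"
      using that(2) unfolding limitin_def by blast
    then obtain i where "\<sigma> i \<in> T" by (meson eventually_sequentially order_refl)
    then show "\<exists>y. y \<in> A \<and> y \<in> T" using that(1) by blast
  qed (use that limitin_topspace in metis)
  then show ?thesis
    unfolding sequential_space_def by blast
qed

lemma first_countable_imp_sequential_space:
  assumes "first_countable Z"
  shows "sequential_space Z"
  unfolding sequential_space_iff
proof (intro allI impI)
  fix A assume A: "A \<subseteq> topspace Z"
    and seq: "\<forall>\<sigma> l. range \<sigma> \<subseteq> A \<and> limitin Z \<sigma> l sequentially \<longrightarrow> l \<in> A"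
  have "x \<in> A" if x: "x \<in> Z closure_of A" for x
  proof -
    have xZ: "x \<in> topspace Z" using x by (simp add: in_closure_of)
    then obtain \<B> where \<B>: "countable \<B>" "\<And>V. V \<in> \<B> \<Longrightarrow> openin Z V"
      "\<And>U. openin Z U \<Longrightarrow> x \<in> U \<Longrightarrow> \<exists>V\<in>\<B>. x \<in> V \<and> V \<subseteq> U"
      using assms unfolding first_countable_def by meson
    let ?C = "{V \<in> \<B>. x \<in> V}"
    have ne: "?C \<noteq> {}" using \<B>(3)[OF openin_topspace xZ] by blast
    have "countable ?C" using \<B>(1) by simp
    define B where "B = from_nat_into ?C"
    have rB: "range B = ?C" unfolding B_def using ne \<open>countable ?C\<close> by (rule range_from_nat_into)
    then have BC: "B j \<in> \<B> \<and> x \<in> B j" for j by (metis (mono_tags, lifting) mem_Collect_eq rangeI)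
    \<comment> \<open>Points are taken from finite intersections of base sets, so that from index
      \<open>j\<close> on the sequence stays in \<open>B j\<close>.\<close>
    have "\<exists>y. y \<in> A \<and> (\<forall>j\<le>i. y \<in> B j)" for i
    proof -
      have "openin Z (\<Inter>j\<in>{..i}. B j)"
        by (rule openin_Inter) (use BC \<B>(2) in auto)
      moreover have "x \<in> (\<Inter>j\<in>{..i}. B j)"
        using BC by blast
      ultimately obtain y where "y \<in> A" "y \<in> (\<Inter>j\<in>{..i}. B j)"
        using x unfolding in_closure_of by meson
      then show ?thesis by blast
    qed
    then obtain \<sigma> where \<sigma>: "\<And>i. \<sigma> i \<in> A" "\<And>i j. j \<le> i \<Longrightarrow> \<sigma> i \<in> B j" by metis
    have "limitin Z \<sigma> x sequentially"
      unfolding limitin_def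
    proof (intro conjI allI impI)
      fix U assume "openin Z U \<and> x \<in> U"
      then obtain V where V: "V \<in> ?C" "V \<subseteq> U" using \<B>(3) by blast
      then obtain j where "V = B j" using rB by blast
      with V \<sigma>(2) have "\<sigma> i \<in> U" if "i \<ge> j" for i using that by blast
      then show "\<forall>\<^sub>F i in sequentially. \<sigma> i \<in> U"
        using eventually_sequentially by blast
    qed (rule xZ)
    then show ?thesis using seq \<sigma>(1) by blast
  qed
  then have "Z closure_of A \<subseteq> A" by blast
  then show "closedin Z A" using A closure_of_subset_eq by metis
qed

text \<open>The union of the closures of the countable subsets of \<open>A\<close> is sequentially closed.\<close>

lemma sequential_space_countable_tightness:
  assumes Z: "sequential_space Z" and A: "A \<subseteq> topspace Z" and x: "x \<in> Z closure_of A"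
  obtains C where "countable C" "C \<subseteq> A" "x \<in> Z closure_of C"
proof -
  define B where "B = \<Union>{Z closure_of C |C. countable C \<and> C \<subseteq> A}"
  have "closedin Z B"
  proof (rule Z[unfolded sequential_space_iff, rule_format])
    show "B \<subseteq> topspace Z"
      unfolding B_def using closure_of_subset_topspace[of Z] by blast
    fix \<sigma> :: "nat \<Rightarrow> 'a" and l assume \<sigma>: "range \<sigma> \<subseteq> B \<and> limitin Z \<sigma> l sequentially"
    then have "\<forall>i. \<exists>C. countable C \<and> C \<subseteq> A \<and> \<sigma> i \<in> Z closure_of C"
      unfolding B_def by blast
    then obtain C where C: "\<And>i. countable (C i) \<and> C i \<subseteq> A \<and> \<sigma> i \<in> Z closure_of C i"
      by metis
    have "\<sigma> i \<in> Z closure_of (\<Union>i. C i)" for i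
      using C[of i] closure_of_mono[of "C i" "\<Union>i. C i" Z] by blast
    then have "l \<in> Z closure_of (\<Union>i. C i)"
      using \<sigma> limitin_closedin[of Z \<sigma> l sequentially "Z closure_of (\<Union>i. C i)"] by simp
    moreover have "countable (\<Union>i. C i)" "(\<Union>i. C i) \<subseteq> A" using C by auto
    ultimately show "l \<in> B" unfolding B_def by blast
  qed
  moreover have "A \<subseteq> B"
  proof
    fix a assume "a \<in> A"
    then have "a \<in> Z closure_of {a}" using A closure_of_subset[of "{a}" Z] by blast
    then show "a \<in> B" unfolding B_def using \<open>a \<in> A\<close>
      by (intro UnionI[of "Z closure_of {a}"] CollectI exI[of _ "{a}"]) auto
  qed
  ultimately have "x \<in> B" using x closure_of_minimal by blast
  then show thesis using that unfolding B_def by blast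
qed

section \<open>Metric spaces\<close>

lemma zero_dimensional_spaceD:
  assumes "zero_dimensional_space X" "openin X U" "x \<in> U"
  shows "\<exists>V. openin X V \<and> closedin X V \<and> x \<in> V \<and> V \<subseteq> U"
  using assms unfolding zero_dimensional_space_def by meson

context Metric_space
begin

text \<open>For each \<open>n\<close> the balls of radius 1/(n+1) have a countable subcover; the
  centres retained for all \<open>n\<close> together are dense.\<close>

lemma Lindelof_space_imp_separable_space:
  assumes L: "Lindelof_space mtopology"
  shows "separable_space mtopology"
proof -
  have "\<exists>C. countable C \<and> C \<subseteq> M \<and> M \<subseteq> (\<Union>c\<in>C. mball c (1 / Suc n))" for n
  proof -
    have "\<Union>((\<lambda>c. mball c (1 / Suc n)) ` M) = topspace mtopology" by auto
    then obtain \<V> where \<V>: "countable \<V>" "\<V> \<subseteq> (\<lambda>c. mball c (1 / Suc n)) ` M" "\<Union>\<V> = M"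
      using Lindelof_spaceD[OF L, of "(\<lambda>c. mball c (1 / Suc n)) ` M"] by auto
    obtain C where "countable C" "C \<subseteq> M" "\<V> = (\<lambda>c. mball c (1 / Suc n)) ` C"
      using countable_subset_image[THEN iffD1, OF conjI, OF \<V>(1,2)] by (elim exE conjE)
    with \<V>(3) show ?thesis by (intro exI[of _ C]) simp
  qed
  then obtain C where C: "\<And>n. countable (C n)" "\<And>n. C n \<subseteq> M"
    "\<And>n. M \<subseteq> (\<Union>c\<in>C n. mball c (1 / Suc n))"
    by metis
  have "M \<subseteq> mtopology closure_of (\<Union>n. C n)"
  proof
    fix x assume x: "x \<in> M"
    show "x \<in> mtopology closure_of (\<Union>n. C n)"
      unfolding metric_closure_of
    proof (intro CollectI conjI allI impI x)
      fix r :: real assume "0 < r"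
      then obtain n where n: "1 / Suc n < r" using nat_approx_posE by blast
      obtain c where "c \<in> C n" "x \<in> mball c (1 / Suc n)" using C(3)[of n] x by blast
      then show "\<exists>y\<in>\<Union>n. C n. y \<in> mball x r"
        using n by (intro bexI[of _ c]) (auto simp: commute)
    qed
  qed
  then show ?thesis
    unfolding separable_space_def using C(1,2)
    by (intro exI[of _ "\<Union>n. C n"] conjI countable_UN)
      (auto dest: subsetD[OF closure_of_subset_topspace])
qed

lemma separable_space_imp_second_countable:
  assumes "separable_space mtopology"
  shows "second_countable mtopology"
proof -
  obtain C where C: "countable C" "C \<subseteq> M" "mtopology closure_of C = M"
    using assms by (auto simp: separable_space_def)
  define \<B> where "\<B> = (\<lambda>(c, n). mball c (1 / Suc n)) ` (C \<times> UNIV)"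
  have "countable \<B>" unfolding \<B>_def using C(1) by auto
  moreover have "openin mtopology V" if "V \<in> \<B>" for V
    using that by (auto simp: \<B>_def)
  moreover have "\<exists>V\<in>\<B>. x \<in> V \<and> V \<subseteq> U" if U: "openin mtopology U" "x \<in> U" for U x
  proof -
    obtain r where r: "r > 0" "mball x r \<subseteq> U" and x: "x \<in> M"
      using U unfolding openin_mtopology by blast
    obtain n where n: "1 / Suc n < r / 2" using nat_approx_posE[of "r / 2"] r by auto
    have "x \<in> mtopology closure_of C" using C x by simp
    then obtain c where c: "c \<in> C" "c \<in> mball x (1 / Suc n)"
      unfolding metric_closure_of mem_Collect_eq by (metis of_nat_0_less_iff zero_less_Suc zero_less_divide_1_iff)
    have "mball c (1 / Suc n) \<subseteq> mball x r"
    proof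
      fix y assume "y \<in> mball c (1 / Suc n)"
      then show "y \<in> mball x r"
        using c n triangle[of x c y] by auto
    qed
    moreover have "x \<in> mball c (1 / Suc n)" using c by (auto simp: commute)
    ultimately show ?thesis
      using c(1) r(2) by (intro bexI[of _ "mball c (1 / Suc n)"]) (auto simp: \<B>_def)
  qed
  ultimately show ?thesis unfolding second_countable_def by (intro exI[of _ \<B>]) simp
qed

text \<open>Failure of sequential compactness only excludes subsequences with a limit inside
  \<open>S\<close>; closedness of \<open>S\<close> extends this to limits anywhere in the
  space.\<close>

lemma noncompact_sequence:
  assumes "closedin mtopology S" "\<not> compactin mtopology S"
  obtains w :: "nat \<Rightarrow> 'a" where "range w \<subseteq> S" "\<And>r l. strict_mono r \<Longrightarrow> \<not> limitin mtopology (w \<circ> r) l sequentially"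
proof -
  have "S \<subseteq> M" using closedin_subset[OF assms(1)] by simp
  then obtain w :: "nat \<Rightarrow> 'a" where w: "range w \<subseteq> S"
    "\<And>r l. l \<in> S \<Longrightarrow> strict_mono r \<Longrightarrow> \<not> limitin mtopology (w \<circ> r) l sequentially"
    using assms(2) unfolding compactin_sequentially by blast
  have "l \<in> S" if "limitin mtopology (w \<circ> r) l sequentially" for r l
  proof (rule limitin_closedin[OF that assms(1)])
    have "(w \<circ> r) n \<in> S" for n using w(1) by (auto simp: image_subset_iff)
    then show "\<forall>\<^sub>F n in sequentially. (w \<circ> r) n \<in> S" by simp
  qed simp
  then show thesis using that[of w] w by metis
qed

text \<open>If \<open>K\<close> met infinitely many of these balls, points of \<open>K\<close> in
  them would have a convergent subsequence, and as the radii tend to 0, the corresponding centres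
  would converge to the same limit.\<close>

lemma compactin_mball_eventually_disjoint:
  assumes w: "\<And>r l. strict_mono r \<Longrightarrow> \<not> limitin mtopology (w \<circ> r) l sequentially"
    and K: "compactin mtopology K"
  shows "\<exists>N. \<forall>n\<ge>N. K \<inter> mball (w n) (1 / Suc n) = {}"
proof (rule ccontr)
  assume "\<not> ?thesis"
  then have inf: "infinite {n. K \<inter> mball (w n) (1 / Suc n) \<noteq> {}}"
    unfolding infinite_nat_iff_unbounded_le by blast
  define r where "r = enumerate {n. K \<inter> mball (w n) (1 / Suc n) \<noteq> {}}"
  have r: "strict_mono r" unfolding r_def using inf by (rule strict_mono_enumerate)
  have "\<exists>y. y \<in> K \<and> y \<in> mball (w (r n)) (1 / Suc (r n))" for n
    using enumerate_in_set[OF inf, of n] by (auto simp: r_def)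
  then obtain y where y: "\<And>n. y n \<in> K" "\<And>n. y n \<in> mball (w (r n)) (1 / Suc (r n))"
    by metis
  obtain l s where s: "strict_mono s" and lim: "limitin mtopology (y \<circ> s) l sequentially"
    using K y(1) unfolding compactin_sequentially by (metis image_subsetI)
  have "limitin mtopology (w \<circ> (r \<circ> s)) l sequentially"
    unfolding limit_metric_sequentially
  proof (intro conjI allI impI)
    show l: "l \<in> M" using limitin_topspace[OF lim] by simp
    fix e :: real assume e: "e > 0"
    then obtain N where N: "\<And>n. n \<ge> N \<Longrightarrow> y (s n) \<in> M \<and> d (y (s n)) l < e / 2"
      using lim unfolding limit_metric_sequentially by (metis comp_apply half_gt_zero)
    obtain N' where N': "1 / Suc N' < e / 2" using nat_approx_posE[of "e / 2"] e by auto
    have "(w \<circ> (r \<circ> s)) n \<in> M \<and> d ((w \<circ> (r \<circ> s)) n) l < e" if n: "n \<ge> max N N'" for n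
    proof -
      have "N' \<le> r (s n)" using seq_suble[OF strict_mono_o[OF r s], of n] n by simp
      then have "1 / Suc (r (s n)) \<le> 1 / Suc N'" by (simp add: frac_le)
      then have "d (w (r (s n))) (y (s n)) < e / 2" using y(2)[of "s n"] N' by auto
      then show ?thesis
        using triangle[of "w (r (s n))" "y (s n)" l] y(2)[of "s n"] N[of n] l n by auto
    qed
    then show "\<exists>N. \<forall>n\<ge>N. (w \<circ> (r \<circ> s)) n \<in> M \<and> d ((w \<circ> (r \<circ> s)) n) l < e" by blast
  qed
  then show False using w strict_mono_o[OF r s] by blast
qed

lemma compactin_insert_limit:
  assumes "limitin mtopology w l sequentially" "range w \<subseteq> M"
  shows "compactin mtopology (insert l (range w))"
  unfolding compactin_def
proof (intro conjI allI impI)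
  have l: "l \<in> M" using limitin_topspace[OF assms(1)] by simp
  then show "insert l (range w) \<subseteq> topspace mtopology" using assms(2) by simp
  fix \<U> assume \<U>: "Ball \<U> (openin mtopology) \<and> insert l (range w) \<subseteq> \<Union>\<U>"
  then obtain U where U: "U \<in> \<U>" "l \<in> U" by blast
  then have "\<forall>\<^sub>F n in sequentially. w n \<in> U"
    using assms(1) \<U> unfolding limitin_def by blast
  then obtain N where N: "\<And>n. n \<ge> N \<Longrightarrow> w n \<in> U" by (auto simp: eventually_sequentially)
  have "\<forall>n. \<exists>V\<in>\<U>. w n \<in> V" using \<U> by blast
  then obtain V where V: "\<And>n. V n \<in> \<U>" "\<And>n. w n \<in> V n" by metis
  have "insert l (range w) \<subseteq> \<Union>(insert U (V ` {..<N}))"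
  proof
    fix x assume "x \<in> insert l (range w)"
    then consider "x = l" | n where "x = w n" by blast
    then show "x \<in> \<Union>(insert U (V ` {..<N}))"
    proof cases
      case 1
      then show ?thesis using U by simp
    next
      case (2 n)
      then show ?thesis using N[of n] V(2)[of n] by (cases "n < N") auto
    qed
  qed
  then show "\<exists>\<F>. finite \<F> \<and> \<F> \<subseteq> \<U> \<and> insert l (range w) \<subseteq> \<Union>\<F>"
    using U V by (intro exI[of _ "insert U (V ` {..<N})"]) auto
qed

text \<open>Clopen sets inside shrinking balls inherit from the balls that a compact set meets only
  finitely many of them. This serves twice: for \<open>S\<close> a closed ball around a point
  without compact neighbourhood, and for \<open>S\<close> the derived set. Avoiding \<open>p\<close>
  makes functions built from the \<open>C n\<close> vanish there.\<close>

lemma noncompact_clopen_sequence: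
  assumes zd: "zero_dimensional_space mtopology"
    and S: "closedin mtopology S" "\<not> compactin mtopology S" and p: "p \<in> M"
  obtains x C where "\<And>n::nat. x n \<in> S" "\<And>n. x n \<in> C n" "\<And>n. openin mtopology (C n)"
    "\<And>n. closedin mtopology (C n)" "\<And>n. p \<notin> C n"
    "\<And>K. compactin mtopology K \<Longrightarrow> \<exists>N. \<forall>n\<ge>N. K \<inter> C n = {}"
proof -
  obtain w :: "nat \<Rightarrow> 'a" where w: "range w \<subseteq> S"
    "\<And>r l. strict_mono r \<Longrightarrow> \<not> limitin mtopology (w \<circ> r) l sequentially"
    using noncompact_sequence[OF S] by metis
  have wM: "w n \<in> M" for n using w(1) closedin_subset[OF S(1)] by auto
  note disj = compactin_mball_eventually_disjoint[of w, OF w(2)]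
  \<comment> \<open>The compact set \<open>{p}\<close> meets only finitely many of the balls, so
    dropping the first \<open>N\<close> terms keeps \<open>p\<close> outside all of them.\<close>
  obtain N where N: "\<And>n. n \<ge> N \<Longrightarrow> p \<notin> mball (w n) (1 / Suc n)"
    using disj[of "{p}"] p by auto
  have "\<exists>V. openin mtopology V \<and> closedin mtopology V \<and> w (n + N) \<in> V \<and>
      V \<subseteq> mball (w (n + N)) (1 / Suc (n + N))" for n
    by (rule zero_dimensional_spaceD[OF zd]) (use wM in auto)
  then obtain C where C: "\<And>n. openin mtopology (C n)" "\<And>n. closedin mtopology (C n)"
    "\<And>n. w (n + N) \<in> C n" "\<And>n. C n \<subseteq> mball (w (n + N)) (1 / Suc (n + N))"
    by metis
  show thesis
  proof (rule that[of "\<lambda>n. w (n + N)" C])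
    show "p \<notin> C n" for n using C(4)[of n] N[of "n + N"] by auto
    fix K assume "compactin mtopology K"
    then obtain N' where "\<And>n. n \<ge> N' \<Longrightarrow> K \<inter> mball (w n) (1 / Suc n) = {}"
      using disj by blast
    then have "K \<inter> C n = {}" if "n \<ge> N'" for n using C(4)[of n] that trans_le_add1 by blast
    then show "\<exists>N. \<forall>n\<ge>N. K \<inter> C n = {}" by blast
  qed (use w(1) C in auto)
qed

end

lemma openin_isolated_point:
  assumes "x \<in> topspace X" "x \<notin> X derived_set_of topspace X"
  shows "openin X {x}"
proof -
  obtain T where T: "openin X T" "x \<in> T" "\<not> (\<exists>y. y \<noteq> x \<and> y \<in> topspace X \<and> y \<in> T)"
    using assms unfolding in_derived_set_of by blast
  then have "T = {x}" using openin_subset[OF T(1)] by blast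
  then show ?thesis using T(1) by simp
qed

lemma openin_isolated_points:
  assumes "S \<subseteq> topspace X - X derived_set_of topspace X"
  shows "openin X S"
proof (subst openin_subopen, intro ballI)
  fix x assume x: "x \<in> S"
  with assms have "openin X {x}" by (intro openin_isolated_point) auto
  with x show "\<exists>T. openin X T \<and> x \<in> T \<and> T \<subseteq> S" by (intro exI[of _ "{x}"]) simp
qed

lemma closedin_superset_derived_set:
  assumes "X derived_set_of topspace X \<subseteq> S" "S \<subseteq> topspace X"
  shows "closedin X S"
  unfolding closedin_def using assms by (auto intro: openin_isolated_points)

section \<open>Consequences of sequentiality\<close>

text \<open>Applied to indicator functions of complements, countable tightness of \<open>C\<^sub>k(X,2)\<close> at the zero
  function reduces a clopen cover that is closed under finite unions to a countable one.\<close>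

lemma sequential_Ck2_imp_Lindelof_space:
  assumes zd: "zero_dimensional_space X" and seq: "sequential_space (Ck2 X)"
  shows "Lindelof_space X"
  unfolding Lindelof_space_alt
proof (intro allI impI)
  fix \<U> assume \<U>: "(\<forall>U\<in>\<U>. openin X U) \<and> topspace X \<subseteq> \<Union>\<U>"
  define \<C> where "\<C> = {V. openin X V \<and> closedin X V \<and> (\<exists>U\<in>\<U>. V \<subseteq> U)}"
  \<comment> \<open>\<open>g F\<close> agrees with the zero function on a compact set
    \<open>K\<close> exactly if \<open>K \<subseteq> \<Union>F\<close>, so closeness to zero
    expresses covering.\<close>
  define g where "g F = clopen_char X (topspace X - \<Union>F)" for F
  define \<F> where "\<F> = {F. finite F \<and> F \<subseteq> \<C>}"
  define z where "z = clopen_char X {}"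
  have z: "z \<in> continuous_functions X Z2_topology"
    unfolding z_def by (rule clopen_char_in) auto
  have g: "g F \<in> continuous_functions X Z2_topology" if "F \<in> \<F>" for F
  proof -
    have "openin X (\<Union>F)" "closedin X (\<Union>F)"
      using that by (auto simp: \<F>_def \<C>_def intro!: openin_Union closedin_Union)
    then show ?thesis
      unfolding g_def by (intro clopen_char_in openin_diff closedin_diff) simp_all
  qed
  have "z \<in> Ck2 X closure_of (g ` \<F>)"
  proof (subst in_Ck2_closure_of)
    show "g ` \<F> \<subseteq> continuous_functions X Z2_topology" using g by blast
    have "\<exists>h\<in>g ` \<F>. \<forall>x\<in>K. h x = z x" if K: "compactin X K" for K
    proof -
      have "K \<subseteq> \<Union>\<C>"
      proof
        fix x assume "x \<in> K"
        then obtain U where U: "U \<in> \<U>" "x \<in> U"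
          using \<U> compactin_subset_topspace[OF K] by blast
        with \<U> have "openin X U" by blast
        with U zero_dimensional_spaceD[OF zd] show "x \<in> \<Union>\<C>"
          unfolding \<C>_def by blast
      qed
      moreover have "\<forall>V\<in>\<C>. openin X V" by (simp add: \<C>_def)
      ultimately obtain F where F: "finite F" "F \<subseteq> \<C>" "K \<subseteq> \<Union>F"
        using K unfolding compactin_def by meson
      have "\<forall>x\<in>K. g F x = z x"
        using F(3) compactin_subset_topspace[OF K]
        by (auto simp: g_def z_def subset_iff simp del: Union_iff)
      moreover have "F \<in> \<F>" using F by (simp add: \<F>_def)
      ultimately show ?thesis by blast
    qed
    with z show "z \<in> continuous_functions X Z2_topology \<and>
        (\<forall>K. compactin X K \<longrightarrow> (\<exists>h\<in>g ` \<F>. \<forall>x\<in>K. h x = z x))" by blast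
  qed
  moreover have gF: "g ` \<F> \<subseteq> topspace (Ck2 X)" using g by auto
  ultimately obtain C where C: "countable C" "C \<subseteq> g ` \<F>" "z \<in> Ck2 X closure_of C"
    using sequential_space_countable_tightness[OF seq] by metis
  obtain G where G: "countable G" "G \<subseteq> \<F>" "C = g ` G"
    using countable_subset_image[THEN iffD1, OF conjI, OF C(1,2)] by (elim exE conjE)
  have "C \<subseteq> continuous_functions X Z2_topology" using C(2) gF by simp
  note cl = C(3)[unfolded in_Ck2_closure_of[OF this]]
  have "\<forall>V\<in>\<Union>G. \<exists>U\<in>\<U>. V \<subseteq> U" using G(2) by (auto simp: \<F>_def \<C>_def)
  then obtain u where u: "\<And>V. V \<in> \<Union>G \<Longrightarrow> u V \<in> \<U> \<and> V \<subseteq> u V" by metis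
  have "countable F" if "F \<in> G" for F
    using G(2) that by (auto simp: \<F>_def intro: countable_finite)
  with G(1) have "countable (u ` \<Union>G)"
    using countable_UN[of G "\<lambda>F. F"] by simp
  moreover have "topspace X \<subseteq> \<Union>(u ` \<Union>G)"
  proof
    fix x assume x: "x \<in> topspace X"
    \<comment> \<open>Singletons suffice as compact sets here: agreement with zero at
      \<open>x\<close> of some member of the countable family puts \<open>x\<close> into one of the
      selected sets.\<close>
    then have "compactin X {x}" by simp
    with cl obtain h where "h \<in> C" "h x = z x" by blast
    then obtain F where F: "F \<in> G" "g F x = z x" using G(3) by blast
    then have "x \<in> \<Union>F" using x by (auto simp: g_def z_def split: if_splits)
    then show "x \<in> \<Union>(u ` \<Union>G)" using F u by blast
  qed
  ultimately show "\<exists>\<V>. countable \<V> \<and> \<V> \<subseteq> \<U> \<and> topspace X \<subseteq> \<Union>\<V>"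
    using u by (intro exI[of _ "u ` \<Union>G"]) blast
qed

text \<open>Around a point without compact neighbourhood no closed ball is compact, so each ball of
  radius 1/(n+1) contains an escaping sequence. Compact sets avoid almost all \<open>C n k\<close>
  for each fixed \<open>n\<close> only, whereas points \<open>x n k\<close> with growing
  \<open>n\<close> approach \<open>p\<close>.\<close>

lemma (in Metric_space) noncompact_fan:
  assumes zd: "zero_dimensional_space mtopology" and nlc: "\<not> locally_compact_space mtopology"
  obtains p x C where "p \<in> M" "\<And>n k::nat. x n k \<in> M"
    "\<And>n k::nat. d (x n k) p \<le> 1 / Suc n" "\<And>n k. x n k \<in> C n k"
    "\<And>n k. openin mtopology (C n k)" "\<And>n k. closedin mtopology (C n k)" "\<And>n k. p \<notin> C n k"
    "\<And>n K. compactin mtopology K \<Longrightarrow> \<exists>N. \<forall>k\<ge>N. K \<inter> C n k = {}"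
proof -
  obtain p where p: "p \<in> M"
    "\<And>U K. openin mtopology U \<Longrightarrow> compactin mtopology K \<Longrightarrow> p \<in> U \<Longrightarrow> \<not> U \<subseteq> K"
    using nlc unfolding locally_compact_space_def topspace_mtopology by meson
  have "\<exists>x C. (\<forall>k::nat. x k \<in> mcball p (1 / Suc n) \<and> x k \<in> C k \<and> openin mtopology (C k) \<and>
      closedin mtopology (C k) \<and> p \<notin> C k) \<and>
      (\<forall>K. compactin mtopology K \<longrightarrow> (\<exists>N. \<forall>k\<ge>N. K \<inter> C k = {}))" for n
  proof -
    have "\<not> compactin mtopology (mcball p (1 / Suc n))"
      using p(2)[OF openin_mball[of p "1 / Suc n"], of "mcball p (1 / Suc n)"] p(1)
        mball_subset_mcball[of p "1 / Suc n"] by auto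
    from noncompact_clopen_sequence[OF zd closedin_mcball this p(1)] show ?thesis
      by metis
  qed
  then obtain x C where xC: "\<And>n k. x n k \<in> mcball p (1 / Suc n)" "\<And>n k::nat. x n k \<in> C n k"
    "\<And>n k. openin mtopology (C n k)"
      "\<And>n k. closedin mtopology (C n k)" "\<And>n k. p \<notin> C n k"
      "\<And>n K. compactin mtopology K \<Longrightarrow> \<exists>N. \<forall>k\<ge>N. K \<inter> C n k = {}"
    by metis
  have "x n k \<in> M" "d (x n k) p \<le> 1 / Suc n" for n k
    using xC(1)[of n k] by (auto simp: commute)
  with p(1) xC show thesis using that[of p x C] by blast
qed

text \<open>The indicators of \<open>C n k \<union> V n k\<close> form a set that is sequentially closed, but has the zero
  function in its closure. A sequence of these with \<open>n\<close> constant cannot converge since its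
  pointwise limit is the indicator of the non-isolated point \<open>z n\<close>; one with \<open>n \<rightarrow> \<infinity>\<close> cannot
  converge uniformly on the compact set consisting of the corresponding \<open>x n k\<close> and of \<open>p\<close>.\<close>

lemma (in Metric_space) sequential_Ck2_imp_compact_or_locally_compact:
  assumes zd: "zero_dimensional_space mtopology" and seq: "sequential_space (Ck2 mtopology)"
  shows "compactin mtopology (mtopology derived_set_of M) \<or> locally_compact_space mtopology"
proof (rule ccontr)
  let ?D = "mtopology derived_set_of M" and ?CF = "continuous_functions mtopology Z2_topology"
  assume "\<not> ?thesis"
  then have ncD: "\<not> compactin mtopology ?D" and nlc: "\<not> locally_compact_space mtopology" by auto
  obtain p x C where p: "p \<in> M" and xM: "\<And>n k. x n k \<in> M"
    and xp: "\<And>n k::nat. d (x n k) p \<le> 1 / Suc n" and xC: "\<And>n k::nat. x n k \<in> C n k"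
    and C: "\<And>n k. openin mtopology (C n k)" "\<And>n k. closedin mtopology (C n k)" "\<And>n k. p \<notin> C n k"
      "\<And>n K. compactin mtopology K \<Longrightarrow> \<exists>N. \<forall>k\<ge>N. K \<inter> C n k = {}"
    using noncompact_fan[OF zd nlc] by metis
  have "closedin mtopology ?D"
    by (rule closedin_superset_derived_set)
      (use derived_set_of_subset_topspace[of mtopology M] in auto)
  then obtain z V0 where z: "\<And>n::nat. z n \<in> ?D" "\<And>n. z n \<in> V0 n"
    and V0: "\<And>n. openin mtopology (V0 n)"
      "\<And>n. closedin mtopology (V0 n)" "\<And>n. p \<notin> V0 n"
      "\<And>K. compactin mtopology K \<Longrightarrow> \<exists>N. \<forall>n\<ge>N. K \<inter> V0 n = {}"
    using noncompact_clopen_sequence[OF zd _ ncD p] by metis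
  have zM: "z n \<in> M" for n using z(1)[of n] by (simp add: in_derived_set_of)
  \<comment> \<open>Containment in \<open>V0 n\<close> makes \<open>V n k\<close> leave every
    compact set as \<open>n\<close> grows; the shrinking balls reduce the intersection over
    \<open>k\<close> to the single point \<open>z n\<close>.\<close>
  have "\<exists>V. openin mtopology V \<and> closedin mtopology V \<and> z n \<in> V \<and>
      V \<subseteq> V0 n \<inter> mball (z n) (1 / Suc k)" for n k
    by (rule zero_dimensional_spaceD[OF zd]) (use z V0 zM in \<open>auto intro: openin_Int\<close>)
  then obtain V where V: "\<And>n k. openin mtopology (V n k)" "\<And>n k. closedin mtopology (V n k)"
    "\<And>n k::nat. z n \<in> V n k" "\<And>n k. V n k \<subseteq> V0 n \<inter> mball (z n) (1 / Suc k)"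
    by metis
  define F where "F n k = clopen_char mtopology (C n k \<union> V n k)" for n k
  define zero where "zero = clopen_char mtopology {}"
  have F: "F n k \<in> ?CF" for n k
    unfolding F_def by (intro clopen_char_in openin_Un closedin_Un C V)
  have zero: "zero \<in> ?CF" unfolding zero_def by (rule clopen_char_in) auto
  have F1: "F n k y = (if y \<in> C n k \<or> y \<in> V n k then 1 else 0)" if "y \<in> M" for n k y
    using that by (simp add: F_def)
  have Fp: "F n k p = 0" for n k using p C(3) subsetD[OF V(4), of p n k] V0(3) by (auto simp: F1)
  let ?A = "range (\<lambda>(n, k). F n k)"
  have "closedin (Ck2 mtopology) ?A"
  proof (rule seq[unfolded sequential_space_iff, rule_format])
    show "?A \<subseteq> topspace (Ck2 mtopology)" using F by auto
    fix \<sigma> h assume \<sigma>: "range \<sigma> \<subseteq> ?A \<and> limitin (Ck2 mtopology) \<sigma> h sequentially"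
    then have h: "h \<in> ?CF"
      and unif: "\<And>K. compactin mtopology K \<Longrightarrow> \<forall>\<^sub>F i in sequentially. \<forall>y\<in>K. \<sigma> i y = h y"
      unfolding limitin_Ck2 by (auto simp: eventually_conj_iff)
    have pw: "\<forall>\<^sub>F i in sequentially. \<sigma> i y = h y" if "y \<in> M" for y
      using unif[of "{y}"] that by simp
    have "\<exists>n k. \<sigma> i = F n k" for i
    proof -
      have "\<sigma> i \<in> ?A" using \<sigma> by blast
      then show ?thesis by auto
    qed
    then obtain a b where ab: "\<And>i. \<sigma> i = F (a i) (b i)" by metis
    show "h \<in> ?A"
    \<comment> \<open>Either one pair of indices recurs, and then the limit is that very
      \<open>F n k\<close>; or some \<open>n\<close> recurs while its second indices exceed every
      bound; or \<open>a i\<close> tends to infinity.\<close>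
    proof (cases "\<exists>n k. \<exists>\<^sub>F i in sequentially. a i = n \<and> b i = k")
      case True
      then obtain n k where nk: "\<exists>\<^sub>F i in sequentially. a i = n \<and> b i = k" by blast
      have "h = F n k"
      proof (rule continuous_functions_Z2_eqI[OF h F])
        fix y assume "y \<in> topspace mtopology"
        then have "\<forall>\<^sub>F i in sequentially. \<sigma> i y = h y" using pw by simp
        from frequently_ex[OF frequently_eventually_frequently[OF nk this]]
        obtain i where "a i = n \<and> b i = k" "\<sigma> i y = h y" by (elim exE conjE) simp
        then show "h y = F n k y" using ab by simp
      qed
      then show ?thesis by auto
    next
      case False
      then have nb: "\<forall>\<^sub>F i in sequentially. \<not> (a i = n \<and> b i = k)" for n k
        by (simp add: not_frequently)
      show ?thesis
      proof (cases "\<exists>n. \<exists>\<^sub>F i in sequentially. a i = n")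
        case True
        then obtain n where n: "\<exists>\<^sub>F i in sequentially. a i = n" by blast
        have val: "\<exists>k\<ge>N. h y = F n k y" if y: "y \<in> M" for y N
        proof -
          have "\<forall>\<^sub>F i in sequentially. \<forall>k\<in>{..<N}. \<not> (a i = n \<and> b i = k)"
            by (rule eventually_ball_finite) (use nb in auto)
          note ev = eventually_conj[OF pw[OF y] this]
          obtain i where "a i = n" "\<sigma> i y = h y" "\<forall>k\<in>{..<N}. \<not> (a i = n \<and> b i = k)"
            using frequently_ex[OF frequently_eventually_frequently[OF n ev]] by (elim exE conjE)
          then show ?thesis using ab by (intro exI[of _ "b i"]) force
        qed
        have hz: "h (z n) = 1" using val[OF zM, of 0 n] V(3) by (auto simp: F1 zM)
        have "h y = 0" if y: "y \<in> M" "y \<noteq> z n" for y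
        proof -
          obtain N where N: "\<And>k. k \<ge> N \<Longrightarrow> y \<notin> C n k" using C(4)[of "{y}"] y by auto
          obtain N' where N': "1 / Suc N' < d (z n) y"
            using nat_approx_posE[of "d (z n) y"] y zM by auto
          obtain k where k: "k \<ge> max N N'" "h y = F n k y" using val[OF y(1)] by blast
          have "1 / Suc k \<le> 1 / Suc N'" using k(1) by (simp add: frac_le)
          then have "y \<notin> V n k" using V(4)[of n k] N' by auto
          then show ?thesis using k N by (simp add: F1 y(1))
        qed
        then have "y = z n" if "y \<in> M" "h y = 1" for y
          using that by (cases "y = z n") auto
        then have "{y \<in> topspace mtopology. h y = h (z n)} \<subseteq> {z n}"
          unfolding hz topspace_mtopology by blast
        moreover have "openin mtopology {y \<in> topspace mtopology. h y = h (z n)}"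
          using continuous_functions_Z2_nhd[OF h] zM by simp
        moreover have "z n \<in> {y \<in> topspace mtopology. h y = h (z n)}" using zM by simp
        ultimately have False
          using z(1)[of n] unfolding in_derived_set_of by (meson singletonD subsetD)
        then show ?thesis ..
      next
        case False
        then have na: "\<forall>\<^sub>F i in sequentially. a i \<noteq> n" for n by (simp add: not_frequently)
        define y where "y i = x (a i) (b i)" for i
        have lim: "limitin mtopology y p sequentially"
          unfolding limitin_metric
        proof (intro conjI allI impI p)
          fix e :: real assume "e > 0"
          then obtain N where N: "1 / Suc N < e" using nat_approx_posE by blast
          have "\<forall>\<^sub>F i in sequentially. \<forall>n\<in>{..<N}. a i \<noteq> n"
            by (rule eventually_ball_finite) (use na in auto)
          then show "\<forall>\<^sub>F i in sequentially. y i \<in> M \<and> d (y i) p < e"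
          proof eventually_elim
            case (elim i)
            then have "N \<le> a i" by force
            then have "1 / Suc (a i) \<le> 1 / Suc N" by (simp add: frac_le)
            then show ?case using xp[of "a i" "b i"] N xM by (simp add: y_def)
          qed
        qed
        \<comment> \<open>All terms vanish at \<open>p\<close>, so the continuous limit vanishes at
          \<open>y i\<close> for large \<open>i\<close>. Convergence on the compact set
          \<open>insert p (range y)\<close> would carry this over to \<open>\<sigma> i\<close>,
          which is 1 at \<open>y i\<close>.\<close>
        have hp: "h p = 0"
          using eventually_happens[OF pw[OF p]] ab Fp by auto
        have "openin mtopology {q \<in> topspace mtopology. h q = h p}"
          using continuous_functions_Z2_nhd[OF h] p by simp
        moreover have "p \<in> {q \<in> topspace mtopology. h q = h p}" using p by simp
        ultimately have "\<forall>\<^sub>F i in sequentially. y i \<in> {q \<in> topspace mtopology. h q = h p}"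
          using lim unfolding limitin_def by meson
        moreover have "\<forall>\<^sub>F i in sequentially. \<forall>q\<in>insert p (range y). \<sigma> i q = h q"
          by (rule unif[OF compactin_insert_limit[OF lim]]) (use xM in \<open>auto simp: y_def\<close>)
        ultimately have "\<forall>\<^sub>F i in sequentially. h (y i) = 0 \<and> \<sigma> i (y i) = h (y i)"
          by eventually_elim (use hp in auto)
        then obtain i where "\<sigma> i (y i) = 0" using eventually_happens by fastforce
        moreover have "\<sigma> i (y i) = 1" using xC xM by (simp add: ab y_def F1)
        ultimately show ?thesis by simp
      qed
    qed
  qed
  moreover have "zero \<in> Ck2 mtopology closure_of ?A"
  proof (subst in_Ck2_closure_of)
    show "?A \<subseteq> ?CF" using F by auto
    have "\<exists>g\<in>?A. \<forall>y\<in>K. g y = zero y" if K: "compactin mtopology K" for K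
    proof -
      \<comment> \<open>The order matters: \<open>K\<close> determines \<open>n\<close> through the
        sets \<open>V0\<close>, and only then \<open>k\<close> through the sets
        \<open>C n\<close>.\<close>
      obtain n where n: "K \<inter> V0 n = {}" using V0(4)[OF K] by blast
      obtain k where "K \<inter> C n k = {}" using C(4)[OF K] by blast
      then have "y \<in> M \<and> y \<notin> C n k \<and> y \<notin> V n k" if "y \<in> K" for y
        using n V(4)[of n k] compactin_subset_topspace[OF K] that unfolding topspace_mtopology by blast
      then have "\<forall>y\<in>K. F n k y = zero y" by (simp add: F1 zero_def)
      then show ?thesis by (intro bexI[of _ "F n k"]) auto
    qed
    with zero show "zero \<in> ?CF \<and> (\<forall>K. compactin mtopology K \<longrightarrow> (\<exists>g\<in>?A. \<forall>y\<in>K. g y = zero y))"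
      by blast
  qed
  ultimately have "zero \<in> ?A" by (simp add: closure_of_closedin)
  then obtain n k where "zero = F n k" by auto
  then have "zero (x n k) = 1" using xC xM by (simp add: F1)
  then show False using xM by (simp add: zero_def)
qed

section \<open>Complete metrizability when the derived set is compact\<close>

text \<open>An open \<open>W\<close> that meets \<open>S\<close> only in \<open>x\<close> has no
  other point at all: \<open>W - {x}\<close> is open and misses the dense set
  \<open>S\<close>.\<close>

lemma openin_dense_isolated:
  assumes Y: "Hausdorff_space Y" and dense: "Y closure_of S = topspace Y" and SY: "S \<subseteq> topspace Y"
    and x: "x \<in> S" "openin (subtopology Y S) {x}"
  shows "openin Y {x}"
proof -
  obtain W where W: "openin Y W" "{x} = W \<inter> S"
    using x(2) by (auto simp: openin_subtopology)
  have "closedin Y {x}"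
    using x(1) SY Y by (intro closedin_Hausdorff_singleton) auto
  then have op: "openin Y (W - {x})" using W(1) by (intro openin_diff)
  have "W - {x} = {}"
  proof (rule ccontr)
    assume "W - {x} \<noteq> {}"
    then obtain y where y: "y \<in> W - {x}" by blast
    then have "y \<in> Y closure_of S" using openin_subset[OF W(1)] dense by blast
    then obtain s where "s \<in> S" "s \<in> W - {x}" using y op unfolding in_closure_of by meson
    then show False using W(2) by blast
  qed
  then have "W = {x}" using W(2) by blast
  then show ?thesis using W(1) by simp
qed

text \<open>In the completion the isolated points remain open, so \<open>M\<close> is the union of an open set and
  of a compact set.\<close>

lemma (in Metric_space) compact_derived_set_imp_completely_metrizable_space:
  assumes D: "compactin mtopology (mtopology derived_set_of M)"
  shows "completely_metrizable_space mtopology"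
proof -
  let ?D = "mtopology derived_set_of M"
  obtain f :: "['a,'a] \<Rightarrow> real" and m' where
    m': "mcomplete_of m'" and fim: "f \<in> M \<rightarrow> mspace m'"
    and clo: "mtopology_of m' closure_of f ` M = mspace m'"
    and d: "\<And>x y. \<lbrakk>x \<in> M; y \<in> M\<rbrakk> \<Longrightarrow> mdist m' (f x) (f y) = d x y"
    by (metis metric_completion)
  let ?Y = "mtopology_of m'"
  have "embedding_map mtopology ?Y f"
    using d fim unfolding mtopology_of_def
    by (metis Metric_space12.isometry_imp_embedding_map Metric_space12_mspace_mdist mdist_metric mspace_metric mtopology_of_def)
  then have hom: "homeomorphic_map mtopology (subtopology ?Y (f ` M)) f"
    by (simp add: embedding_map_def)
  have Y: "Hausdorff_space ?Y" "metrizable_space ?Y" "completely_metrizable_space ?Y"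
    using m' unfolding mtopology_of_def mcomplete_of_def
    by (simp_all add: Metric_space.Hausdorff_space_mtopology Metric_space.metrizable_space_mtopology
        Metric_space.completely_metrizable_space_mtopology)
  have fM: "f ` M \<subseteq> topspace ?Y" using fim by auto
  have DM: "?D \<subseteq> M" using derived_set_of_subset_topspace[of mtopology M] by simp
  have "openin ?Y {f x}" if x: "x \<in> M - ?D" for x
  proof (rule openin_dense_isolated[OF Y(1) _ fM])
    show "?Y closure_of f ` M = topspace ?Y" using clo by simp
    have "openin mtopology {x}" using x by (intro openin_isolated_point) auto
    then have "openin (subtopology ?Y (f ` M)) (f ` {x})"
      using homeomorphic_map_openness[OF hom, of "{x}"] x by auto
    then show "openin (subtopology ?Y (f ` M)) {f x}" by simp
  qed (use x in auto)
  then have "openin ?Y (\<Union>((\<lambda>x. {f x}) ` (M - ?D)))"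
    by (intro openin_Union) auto
  moreover have "\<Union>((\<lambda>x. {f x}) ` (M - ?D)) = f ` (M - ?D)" by auto
  ultimately have 1: "gdelta_in ?Y (f ` (M - ?D))" by (simp add: open_imp_gdelta_in)
  have "compactin (subtopology ?Y (f ` M)) (f ` ?D)"
    using homeomorphic_map_compactness[OF hom, of ?D] D DM by simp
  then have "closedin ?Y (f ` ?D)"
    using Y(1) by (auto simp: compactin_subtopology intro: compactin_imp_closedin)
  \<comment> \<open>Closed sets in a metrizable space are G_delta. So the image of \<open>M\<close>
    is a union of two G_delta sets in the completion, and G_delta subspaces of completely metrizable
    spaces are completely metrizable.\<close>
  then have 2: "gdelta_in ?Y (f ` ?D)" using Y(2) by (rule closed_imp_gdelta_in[rotated])
  have "f ` M = f ` (M - ?D) \<union> f ` ?D" using DM by blast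
  then have "gdelta_in ?Y (f ` M)" using gdelta_in_Un[OF 1 2] by simp
  then have "completely_metrizable_space (subtopology ?Y (f ` M))"
    using Y(3) by (intro completely_metrizable_space_gdelta_in)
  then show ?thesis
    using hom homeomorphic_completely_metrizable_space homeomorphic_map_imp_homeomorphic_space by blast
qed

section \<open>The locally compact case\<close>

text \<open>By compactness such a set is a finite union of members of a countable base. The count is
  used for a dense set of functions and for the number of cosets.\<close>

lemma countable_compact_open:
  assumes "second_countable X"
  shows "countable {U. openin X U \<and> compactin X U}"
proof -
  obtain \<B> where \<B>: "countable \<B>" "\<And>V. V \<in> \<B> \<Longrightarrow> openin X V"
      "\<And>U x. openin X U \<Longrightarrow> x \<in> U \<Longrightarrow> \<exists>V\<in>\<B>. x \<in> V \<and> V \<subseteq> U"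
    using assms unfolding second_countable_def by metis
  have "{U. openin X U \<and> compactin X U} \<subseteq> Union ` {F. F \<subseteq> \<B> \<and> finite F}"
  proof
    fix U assume "U \<in> {U. openin X U \<and> compactin X U}"
    then have U: "openin X U" "compactin X U" by auto
    have "U \<subseteq> \<Union>{V \<in> \<B>. V \<subseteq> U}" using \<B>(3)[OF U(1)] by blast
    moreover have "\<forall>V\<in>{V \<in> \<B>. V \<subseteq> U}. openin X V" using \<B>(2) by simp
    ultimately obtain F where F: "finite F" "F \<subseteq> {V \<in> \<B>. V \<subseteq> U}" "U \<subseteq> \<Union>F"
      using U(2) unfolding compactin_def by meson
    then have "U = \<Union>F" by blast
    with F show "U \<in> Union ` {F. F \<subseteq> \<B> \<and> finite F}" by blast
  qed
  moreover have "countable {F. F \<subseteq> \<B> \<and> finite F}"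
    using countable_Collect_finite_subset[OF \<B>(1)] by (simp add: conj_commute)
  ultimately show ?thesis by (rule countable_subset[OF _ countable_image])
qed

text \<open>Local compactness and the clopen base give a cover by compact open sets, which the
  Lindelof property makes countable. Subtracting the earlier sets keeps each of them compact and
  open, because compact sets are closed here.\<close>

lemma compact_open_partition:
  assumes zd: "zero_dimensional_space X" and lc: "locally_compact_space X"
    and H: "Hausdorff_space X" and L: "Lindelof_space X"
  obtains L :: "nat \<Rightarrow> 'a set"
  where "\<And>n. openin X (L n)" "\<And>n. compactin X (L n)" "disjoint_family L" "(\<Union>n. L n) = topspace X"
proof -
  let ?\<U> = "{U. openin X U \<and> compactin X U}"
  have "topspace X \<subseteq> \<Union>?\<U>"
  proof
    fix x assume x: "x \<in> topspace X"
    then obtain U K where U: "openin X U" "compactin X K" "x \<in> U" "U \<subseteq> K"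
      using lc unfolding locally_compact_space_def by meson
    then obtain V where V: "openin X V" "closedin X V" "x \<in> V" "V \<subseteq> U"
      using zero_dimensional_spaceD[OF zd] by meson
    then have "compactin X V" using closed_compactin[OF U(2) _ V(2)] U(4) by blast
    then show "x \<in> \<Union>?\<U>" using V by blast
  qed
  then obtain \<V> where \<V>: "countable \<V>" "\<V> \<subseteq> ?\<U>" "topspace X \<subseteq> \<Union>\<V>"
    using L[unfolded Lindelof_space_alt, rule_format, of ?\<U>] by auto
  \<comment> \<open>The empty set is added so that the enumeration has the right range even if
    \<open>\<V>\<close> is empty; empty pieces do no harm.\<close>
  define B where "B = from_nat_into (insert {} \<V>)"
  have rB: "range B = insert {} \<V>"
    unfolding B_def using \<V>(1) by (intro range_from_nat_into) auto
  have B: "openin X (B n)" "compactin X (B n)" for n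
  proof -
    have "B n \<in> insert {} \<V>" using rB by blast
    then show "openin X (B n)" "compactin X (B n)" using \<V>(2) by auto
  qed
  have cl: "closedin X (B n)" for n using H B(2) by (rule compactin_imp_closedin)
  have clU: "closedin X (\<Union>i\<in>{0..<n}. B i)" for n by (intro closedin_Union) (use cl in auto)
  show thesis
  proof (rule that[of "disjointed B"])
    show "openin X (disjointed B n)" for n
      unfolding disjointed_def using B(1) clU by (intro openin_diff)
    have "openin X (\<Union>i\<in>{0..<n}. B i)" for n by (intro openin_Union) (use B in auto)
    then have "closedin X (disjointed B n)" for n
      unfolding disjointed_def using cl by (intro closedin_diff)
    then show "compactin X (disjointed B n)" for n
      using closed_compactin[OF B(2)[of n] _] disjointed_subset[of B n] by blast
    show "disjoint_family (disjointed B)" by (rule disjoint_family_disjointed)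
    have "(\<Union>n. B n) = topspace X"
      using rB \<V>(3) B(1) openin_subset by fastforce
    then show "(\<Union>n. disjointed B n) = topspace X" by (simp add: UN_disjointed_eq)
  qed
qed

context
  fixes X :: "'a topology" and L :: "nat \<Rightarrow> 'a set"
  assumes L: "\<And>n. openin X (L n)" "\<And>n. compactin X (L n)" "disjoint_family L"
    "(\<Union>n. L n) = topspace X"
begin

lemma compactin_subset_initial_part:
  assumes "compactin X K"
  shows "\<exists>N. K \<subseteq> (\<Union>n<N. L n)"
proof -
  have "K \<subseteq> \<Union>(range L)" using compactin_subset_topspace[OF assms] L(4) by simp
  then obtain F where F: "finite F" "F \<subseteq> range L" "K \<subseteq> \<Union>F"
    using assms L(1) unfolding compactin_def by (metis (no_types, lifting) imageE)
  obtain J where J: "finite J" "F = L ` J" using finite_subset_image[OF F(1,2)] by auto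
  obtain N where "J \<subseteq> {..<N}" using finite_nat_bounded[OF J(1)] by blast
  then have "\<Union>F \<subseteq> (\<Union>n<N. L n)" unfolding J(2) by (rule UN_mono) simp
  with F(3) show ?thesis by (intro exI[of _ N]) (rule order_trans)
qed

text \<open>A continuous function is an arbitrary choice of continuous functions on the open pieces,
  and a compact set lies in finitely many pieces, which are themselves compact. So restriction to
  the pieces is a homeomorphism onto a product of discrete spaces.\<close>

lemma completely_metrizable_space_Ck2_partition: "completely_metrizable_space (Ck2 X)"
proof -
  let ?CF = "continuous_functions X Z2_topology"
  define R where "R n = (\<lambda>f. restrict f (L n)) ` ?CF" for n
  define \<Phi> where "\<Phi> f = (\<lambda>n. restrict f (L n))" for f :: "'a \<Rightarrow> int"
  let ?P = "product_topology (\<lambda>n. discrete_topology (R n)) UNIV"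
  have LX: "L n \<subseteq> topspace X" for n using L(4) by blast
  have agree: "(\<forall>x\<in>L n. g x = f x) \<longleftrightarrow> \<Phi> g n = \<Phi> f n" for f g n
    unfolding \<Phi>_def by (metis restrict_apply' restrict_ext)
  have "homeomorphic_map (Ck2 X) ?P \<Phi>"
  proof (rule bijective_open_imp_homeomorphic_map)
    show "continuous_map (Ck2 X) ?P \<Phi>"
      unfolding continuous_map_componentwise_UNIV
    proof
      fix n
      show "continuous_map (Ck2 X) (discrete_topology (R n)) (\<lambda>f. \<Phi> f n)"
        unfolding continuous_map_def
      proof (intro conjI allI impI)
        show "(\<lambda>f. \<Phi> f n) \<in> topspace (Ck2 X) \<rightarrow> topspace (discrete_topology (R n))"
          by (auto simp: \<Phi>_def R_def)
        fix U
        show "openin (Ck2 X) {f \<in> topspace (Ck2 X). \<Phi> f n \<in> U}"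
          unfolding openin_Ck2 by (auto intro!: exI[of _ "L n"] L(2) simp: agree)
      qed
    qed
    show surj: "\<Phi> ` topspace (Ck2 X) = topspace ?P"
    proof
      show "\<Phi> ` topspace (Ck2 X) \<subseteq> topspace ?P" by (auto simp: \<Phi>_def R_def)
      show "topspace ?P \<subseteq> \<Phi> ` topspace (Ck2 X)"
      proof
        fix y assume "y \<in> topspace ?P"
        then have "\<forall>n. \<exists>f\<in>?CF. y n = restrict f (L n)" by (auto simp: R_def PiE_iff)
        then obtain c where c: "\<And>n. c n \<in> ?CF" "\<And>n. y n = restrict (c n) (L n)" by metis
        \<comment> \<open>The prescribed restrictions are glued: \<open>THE n\<close> picks the
          unique piece containing \<open>x\<close>, and openness of the pieces gives
          continuity.\<close>
        define g where "g = (\<lambda>x\<in>topspace X. c (THE n. x \<in> L n) x)"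
        have g: "g x = c n x" if "x \<in> L n" for n x
        proof -
          have "(THE n. x \<in> L n) = n"
            using that L(3) by (intro the_equality) (auto simp: disjoint_family_on_def)
          then show ?thesis using that LX by (auto simp: g_def)
        qed
        have op: "openin X {x \<in> topspace X. g x = v}" if "v \<in> {0, 1}" for v
        proof -
          have "{x \<in> topspace X. g x = v} = (\<Union>n. L n \<inter> {x \<in> topspace X. c n x = v})"
            unfolding L(4)[symmetric] using g by auto
          moreover have "openin X {x \<in> topspace X. c n x = v}" for n
            using c(1)[of n] that by (auto simp: continuous_functions_Z2_iff)
          ultimately show ?thesis using L(1) by (auto intro!: openin_Union openin_Int)
        qed
        have "g x \<in> {0, 1}" if "x \<in> topspace X" for x
        proof -
          have "x \<in> (\<Union>n. L n)" using that L(4) by simp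
          then obtain n where "x \<in> L n" by blast
          then show ?thesis using g continuous_functions_Z2_values[OF c(1) that] by simp
        qed
        then have "g \<in> ?CF"
          using op unfolding continuous_functions_Z2_iff by (simp add: g_def)
        moreover have "\<Phi> g = y" using g by (auto simp: \<Phi>_def c(2) intro!: ext)
        ultimately show "y \<in> \<Phi> ` topspace (Ck2 X)" by auto
      qed
    qed
    show "inj_on \<Phi> (topspace (Ck2 X))"
    proof (rule inj_onI)
      fix f g assume fg: "f \<in> topspace (Ck2 X)" "g \<in> topspace (Ck2 X)" "\<Phi> f = \<Phi> g"
      then have eq: "\<forall>x\<in>L n. f x = g x" for n by (simp add: agree)
      have "f x = g x" if "x \<in> topspace X" for x
        using eq that unfolding L(4)[symmetric] by blast
      then show "f = g"
        using fg(1,2) by (intro continuous_functions_Z2_eqI[of f X g]) auto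
    qed
    show "open_map (Ck2 X) ?P \<Phi>"
      unfolding open_map_def
    proof (intro allI impI)
      fix W assume W: "openin (Ck2 X) W"
      show "openin ?P (\<Phi> ` W)"
        unfolding openin_product_topology_alt
      proof
        fix y assume "y \<in> \<Phi> ` W"
        then obtain f where f: "f \<in> W" "y = \<Phi> f" by blast
        obtain K where K: "compactin X K" "{g \<in> ?CF. \<forall>x\<in>K. g x = f x} \<subseteq> W"
          using W f(1) by (rule openin_Ck2E)
        obtain N where N: "K \<subseteq> (\<Union>n<N. L n)" using compactin_subset_initial_part[OF K(1)] by blast
        \<comment> \<open>Agreement with \<open>f\<close> on the first \<open>N\<close> pieces
          forces agreement on \<open>K\<close>; the remaining coordinates stay free, as a basic open
          set of the product requires.\<close>
        define U where "U n = (if n < N then {\<Phi> f n} else R n)" for n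
        have fCF: "f \<in> ?CF" using f(1) openin_subset[OF W] by auto
        then have fR: "\<Phi> f n \<in> R n" for n by (simp add: \<Phi>_def R_def)
        have "finite {n \<in> UNIV. U n \<noteq> topspace (discrete_topology (R n))}"
          by (rule finite_subset[of _ "{..<N}"]) (auto simp: U_def)
        moreover have "\<forall>n\<in>UNIV. openin (discrete_topology (R n)) (U n)" using fR by (simp add: U_def)
        moreover have "y \<in> Pi\<^sub>E UNIV U" using fR f(2) by (auto simp: U_def)
        moreover have "Pi\<^sub>E UNIV U \<subseteq> \<Phi> ` W"
        proof
          fix u assume u: "u \<in> Pi\<^sub>E UNIV U"
          have "u n \<in> R n" for n
            using PiE_mem[OF u, of n] fR by (auto simp: U_def split: if_splits)
          then have "u \<in> topspace ?P" by (simp add: PiE_iff)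
          then have "u \<in> \<Phi> ` topspace (Ck2 X)" by (simp only: surj)
          then obtain g where g: "g \<in> ?CF" "u = \<Phi> g" by auto
          have "\<forall>x\<in>L n. g x = f x" if "n < N" for n
            unfolding agree using PiE_mem[OF u, of n] that g(2) by (simp add: U_def)
          then have "g \<in> W" using K(2) N g(1) by blast
          then show "u \<in> \<Phi> ` W" using g(2) by blast
        qed
        ultimately show "\<exists>U. finite {n \<in> UNIV. U n \<noteq> topspace (discrete_topology (R n))} \<and>
            (\<forall>n\<in>UNIV. openin (discrete_topology (R n)) (U n)) \<and> y \<in> Pi\<^sub>E UNIV U \<and> Pi\<^sub>E UNIV U \<subseteq> \<Phi> ` W"
          by blast
      qed
    qed
  qed
  then have "Ck2 X homeomorphic_space ?P" by (rule homeomorphic_map_imp_homeomorphic_space)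
  moreover have "completely_metrizable_space ?P"
    unfolding completely_metrizable_space_product_topology
    by (simp add: completely_metrizable_space_discrete_topology)
  ultimately show ?thesis using homeomorphic_completely_metrizable_space by blast
qed

text \<open>Set to zero beyond the first \<open>N\<close> pieces, \<open>f\<close> becomes the
  indicator of a compact open set and still agrees with \<open>f\<close> on every compact set inside
  those pieces. There are only countably many such indicators.\<close>

lemma separable_space_Ck2_partition:
  assumes sc: "second_countable X" and H: "Hausdorff_space X"
  shows "separable_space (Ck2 X)"
proof -
  let ?CF = "continuous_functions X Z2_topology"
  let ?C = "clopen_char X ` {U. openin X U \<and> compactin X U}"
  have C: "?C \<subseteq> ?CF" using H by (auto intro: clopen_char_in compactin_imp_closedin)
  have "f \<in> Ck2 X closure_of ?C" if f: "f \<in> ?CF" for f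
    unfolding in_Ck2_closure_of[OF C]
  proof (intro conjI allI impI f)
    fix K assume "compactin X K"
    then obtain N where N: "K \<subseteq> (\<Union>n<N. L n)" using compactin_subset_initial_part by blast
    let ?U = "(\<Union>n<N. L n) \<inter> {x \<in> topspace X. f x = 1}"
    have "openin X (\<Union>n<N. L n)" using L(1) by (intro openin_Union) auto
    then have "openin X ?U"
      using f by (intro openin_Int) (auto simp: continuous_functions_Z2_iff)
    moreover have "compactin X ?U"
      using continuous_functions_Z2_closedin[OF f] L(2)
      by (intro compact_Int_closedin compactin_Union) auto
    moreover have "clopen_char X ?U x = f x" if "x \<in> K" for x
    proof -
      have x: "x \<in> (\<Union>n<N. L n)" using N that by blast
      then have "x \<in> topspace X" unfolding L(4)[symmetric] by blast
      with x show ?thesis using continuous_functions_Z2_values[OF f, of x] by auto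
    qed
    ultimately show "\<exists>g\<in>?C. \<forall>x\<in>K. g x = f x" by blast
  qed
  then have "Ck2 X closure_of ?C = topspace (Ck2 X)"
    using closure_of_subset_topspace[of "Ck2 X" ?C] by auto
  moreover have "countable ?C" using countable_compact_open[OF sc] by simp
  ultimately show ?thesis unfolding separable_space_def using C by auto
qed

end

lemma Polish_space_Ck2:
  assumes zd: "zero_dimensional_space X" and lc: "locally_compact_space X"
    and sc: "second_countable X" and H: "Hausdorff_space X"
  shows "Polish_space (Ck2 X)"
proof -
  obtain L :: "nat \<Rightarrow> 'a set" where L: "\<And>n. openin X (L n)" "\<And>n. compactin X (L n)" "disjoint_family L"
    "(\<Union>n. L n) = topspace X"
    using compact_open_partition[OF zd lc H second_countable_imp_Lindelof_space[OF sc]] by metis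
  show ?thesis
    unfolding Polish_space_def
    using separable_space_Ck2_partition[OF L sc H] completely_metrizable_space_Ck2_partition[OF L] by blast
qed

section \<open>The case of a compact derived set\<close>

text \<open>This is sequential compactness of a countable product of finite sets. The pigeonhole
  principle settles one coordinate at a time, and the diagonal subsequence serves all of
  them.\<close>

lemma finitely_valued_convergent_subsequence:
  fixes G :: "nat \<Rightarrow> nat \<Rightarrow> int"
  assumes fin: "\<And>p. finite (range (\<lambda>j. G j p))"
  obtains r :: "nat \<Rightarrow> nat" where "strict_mono r" "\<And>p. \<exists>v. \<forall>\<^sub>F j in sequentially. G (r j) p = v"
proof -
  interpret subseqs "\<lambda>p r. \<exists>v. \<forall>\<^sub>F j in sequentially. G (r j) p = v"
  proof
    fix p and s :: "nat \<Rightarrow> nat" assume "strict_mono s"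
    have "finite (range (\<lambda>j. G (s j) p))" using fin[of p] by (rule finite_subset[rotated]) auto
    from pigeonhole_infinite[OF _ this] obtain j0
      where inf: "infinite {j. G (s j) p = G (s j0) p}" by auto
    then have "G (s (enumerate {j. G (s j) p = G (s j0) p} i)) p = G (s j0) p" for i
      using enumerate_in_set[OF inf, of i] by simp
    then show "\<exists>r'. strict_mono r' \<and> (\<exists>v. \<forall>\<^sub>F j in sequentially. G ((s \<circ> r') j) p = v)"
      using strict_mono_enumerate[OF inf] by (intro exI[of _ "enumerate {j. G (s j) p = G (s j0) p}"]) auto
  qed
  show thesis
  proof (rule that[OF subseq_diagseq])
    fix p
    \<comment> \<open>The diagonal sequence is known to be a subsequence of the one chosen for
      coordinate \<open>p\<close> only from index \<open>p + 1\<close> on; the finite shift is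
      removed afterwards.\<close>
    have "\<exists>v. \<forall>\<^sub>F j in sequentially. G ((diagseq \<circ> ((+) (Suc p))) j) p = v"
    proof (rule diagseq_holds)
      fix r s :: "nat \<Rightarrow> nat" and n
      assume r: "strict_mono r" and "\<exists>v. \<forall>\<^sub>F j in sequentially. G (s j) n = v"
      then obtain v where "\<forall>\<^sub>F j in sequentially. G (s j) n = v" by blast
      then have "\<forall>\<^sub>F j in sequentially. G (s (r j)) n = v"
        by (rule eventually_subseq[OF r])
      then show "\<exists>v. \<forall>\<^sub>F j in sequentially. G ((s \<circ> r) j) n = v" by auto
    qed
    then obtain v where "\<forall>\<^sub>F j in sequentially. G (diagseq (j + Suc p)) p = v"
      by (auto simp: add.commute)
    then have "\<forall>\<^sub>F j in sequentially. G (diagseq j) p = v"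
      using eventually_sequentially_seg[of "\<lambda>j. G (diagseq j) p = v" "Suc p"] by simp
    then show "\<exists>v. \<forall>\<^sub>F j in sequentially. G (diagseq j) p = v" by blast
  qed
qed

text \<open>Each level \<open>{e n m | m}\<close> is then closed and discrete, so that a compact set contains only
  finitely many of its points.\<close>

locale isolated_levels =
  fixes X :: "'a topology" and D :: "'a set" and e :: "nat \<Rightarrow> nat \<Rightarrow> 'a"
  assumes D_def: "D = X derived_set_of topspace X"
    and compact_D: "compactin X D"
    and e_inject: "e n m = e n' m' \<Longrightarrow> n = n' \<and> m = m'"
    and e_range: "x \<in> topspace X - D \<longleftrightarrow> (\<exists>n m. x = e n m)"
    and openin_tail: "openin X (D \<union> {e k m |k m. k \<ge> n})"
    and tail_base: "openin X U \<Longrightarrow> D \<subseteq> U \<Longrightarrow> \<exists>n. \<forall>k\<ge>n. \<forall>m. e k m \<in> U"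
begin

abbreviation CF :: "('a \<Rightarrow> int) set" where
  "CF \<equiv> continuous_functions X Z2_topology"

text \<open>Within \<open>CF\<close> these relations give the basic neighbourhoods of
  \<open>f\<close>: \<open>D\<close> with finitely many points of each level is compact, and such
  sets are cofinal among the compact sets.\<close>

definition agree :: "('a \<Rightarrow> int) \<Rightarrow> (nat \<Rightarrow> nat) \<Rightarrow> ('a \<Rightarrow> int) \<Rightarrow> bool" where
  "agree f k g \<longleftrightarrow> (\<forall>x\<in>D. g x = f x) \<and> (\<forall>n m. m < k n \<longrightarrow> g (e n m) = f (e n m))"

lemma D_subset: "D \<subseteq> topspace X"
  unfolding D_def by (rule derived_set_of_subset_topspace)

lemma e_in: "e n m \<in> topspace X" "e n m \<notin> D"
  using e_range by blast+

lemma point_cases: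
  assumes "x \<in> topspace X"
  obtains (derived) "x \<in> D" | (isolated) n m where "x = e n m"
  using assms e_range by blast

lemma openin_disjoint_D: "S \<subseteq> topspace X \<Longrightarrow> S \<inter> D = {} \<Longrightarrow> openin X S"
  by (rule openin_isolated_points) (auto simp: D_def)

text \<open>The set where two continuous functions agree is open; once it contains \<open>D\<close>,
  it contains all late levels by \<open>tail_base\<close>.\<close>

lemma CF_eventually_agree:
  assumes f: "f \<in> CF" and g: "g \<in> CF" and eq: "\<And>x. x \<in> D \<Longrightarrow> g x = f x"
  shows "\<exists>N. \<forall>k\<ge>N. \<forall>m. g (e k m) = f (e k m)"
proof -
  let ?U = "({x \<in> topspace X. f x = 0} \<inter> {x \<in> topspace X. g x = 0}) \<union>
    ({x \<in> topspace X. f x = 1} \<inter> {x \<in> topspace X. g x = 1})"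
  have "openin X ?U"
    using f g by (intro openin_Un openin_Int) (auto simp: continuous_functions_Z2_iff)
  moreover have "x \<in> ?U" if "x \<in> D" for x
    using eq[OF that] subsetD[OF D_subset that] continuous_functions_Z2_values[OF f, of x] by auto
  then have "D \<subseteq> ?U" by (rule subsetI)
  ultimately obtain N where N: "\<forall>k\<ge>N. \<forall>m. e k m \<in> ?U" using tail_base[of ?U] by (elim exE meta_impE)
  have "g (e k m) = f (e k m)" if "k \<ge> N" for k m
  proof -
    have "e k m \<in> ?U" using N that by blast
    then show ?thesis by auto
  qed
  then show ?thesis by blast
qed

text \<open>At isolated points continuity is automatic. At points of \<open>D\<close> it holds
  because \<open>g\<close> equals \<open>f\<close> on the open set formed by \<open>D\<close> and
  the levels from \<open>N\<close> on.\<close>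

lemma CF_modify:
  assumes f: "f \<in> CF" and g: "g \<in> extensional (topspace X)"
    and g01: "\<And>x. x \<in> topspace X \<Longrightarrow> g x \<in> {0, 1}" and eq: "\<And>x. x \<in> D \<Longrightarrow> g x = f x"
    and tail: "\<And>k m. k \<ge> N \<Longrightarrow> g (e k m) = f (e k m)"
  shows "g \<in> CF"
proof -
  have "openin X {x \<in> topspace X. g x = v}" if v: "v \<in> {0, 1}" for v
  proof -
    have eq: "{x \<in> topspace X. g x = v} =
        ((D \<union> {e k m |k m. k \<ge> N}) \<inter> {x \<in> topspace X. f x = v}) \<union> ({x \<in> topspace X. g x = v} - D)"
      using D_subset eq tail by auto
    moreover have "openin X {x \<in> topspace X. f x = v}"
      using f v by (auto simp: continuous_functions_Z2_iff)
    moreover have "openin X ({x \<in> topspace X. g x = v} - D)"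
      by (rule openin_disjoint_D) auto
    ultimately show ?thesis
      by (subst eq) (intro openin_Un openin_Int openin_tail)
  qed
  then show ?thesis using g g01 by (simp add: continuous_functions_Z2_iff Pi_iff)
qed

text \<open>Finitely many members of a cover suffice for \<open>D\<close> and already contain all
  late levels; only finitely many points of the box remain. This works however fast the numbers
  \<open>k n\<close> grow.\<close>

lemma compactin_box: "compactin X (D \<union> {e n m |n m. m < k n})"
  unfolding compactin_def
proof (intro conjI allI impI)
  show "D \<union> {e n m |n m. m < k n} \<subseteq> topspace X" using D_subset e_in by auto
  fix \<U> assume \<U>: "Ball \<U> (openin X) \<and> D \<union> {e n m |n m. m < k n} \<subseteq> \<Union>\<U>"
  then have "D \<subseteq> \<Union>\<U>" by simp
  then obtain F where F: "finite F" "F \<subseteq> \<U>" "D \<subseteq> \<Union>F"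
    using compact_D \<U> unfolding compactin_def by meson
  then have "openin X (\<Union>F)" using \<U> by (intro openin_Union) auto
  with F(3) obtain N where N: "\<And>i m. i \<ge> N \<Longrightarrow> e i m \<in> \<Union>F" using tail_base by metis
  have fin: "finite (\<Union>n<N. e n ` {..<k n})" by simp
  have "(\<Union>n<N. e n ` {..<k n}) \<subseteq> {e n m |n m. m < k n}" by auto
  then have sub: "(\<Union>n<N. e n ` {..<k n}) \<subseteq> \<Union>\<U>"
    using \<U> by (elim conjE) (simp only: Un_subset_iff, elim conjE, rule order_trans)
  obtain F' where F': "finite F'" "F' \<subseteq> \<U>" "(\<Union>n<N. e n ` {..<k n}) \<subseteq> \<Union>F'"
    using finite_subset_Union[OF fin sub] by metis
  have "D \<union> {e n m |n m. m < k n} \<subseteq> \<Union>(F \<union> F')"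
  proof
    fix x assume "x \<in> D \<union> {e n m |n m. m < k n}"
    then consider "x \<in> D" | n m where "x = e n m" "m < k n" by blast
    then show "x \<in> \<Union>(F \<union> F')"
    proof cases
      case 1
      then show ?thesis using F(3) by blast
    next
      case (2 n m)
      then show ?thesis using N[of n m] F'(3) by (cases "n < N") auto
    qed
  qed
  then show "\<exists>\<F>. finite \<F> \<and> \<F> \<subseteq> \<U> \<and> D \<union> {e n m |n m. m < k n} \<subseteq> \<Union>\<F>"
    using F F' by (intro exI[of _ "F \<union> F'"]) auto
qed

text \<open>A level is closed, since its complement consists of the open set of \<open>D\<close>
  with the later levels and of isolated points. As its points are open, its intersection with a
  compact set is finite.\<close>

lemma compactin_level_finite:
  assumes K: "compactin X K"
  shows "finite (K \<inter> range (e n))"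
proof -
  have "e n m \<noteq> e k m'" if "Suc n \<le> k" for k m m'
    using e_inject[of n m k m'] that by auto
  then have eq: "topspace X - range (e n) = (D \<union> {e k m |k m. k \<ge> Suc n}) \<union> (topspace X - range (e n) - D)"
    using D_subset e_in by auto
  have "openin X (topspace X - range (e n) - D)" by (rule openin_disjoint_D) auto
  then have "openin X (topspace X - range (e n))"
    by (subst eq) (intro openin_Un openin_tail)
  then have "closedin X (range (e n))" using e_in by (auto simp: closedin_def)
  then have KS: "compactin X (K \<inter> range (e n))" by (rule compact_Int_closedin[OF K])
  let ?\<U> = "(\<lambda>x. {x}) ` (K \<inter> range (e n))"
  have "\<forall>U\<in>?\<U>. openin X U" using e_in by (auto intro!: openin_disjoint_D)
  moreover have "K \<inter> range (e n) \<subseteq> \<Union>?\<U>" by blast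
  ultimately obtain F where F: "finite F" "F \<subseteq> ?\<U>" "K \<inter> range (e n) \<subseteq> \<Union>F"
    using KS unfolding compactin_def by meson
  have "finite (\<Union>F)" using F(1,2) by auto
  then show ?thesis using F(3) finite_subset by blast
qed

lemma compactin_box_bound:
  assumes "compactin X K"
  obtains k where "\<And>n m. e n m \<in> K \<Longrightarrow> m < k n"
proof -
  have "\<exists>b. \<forall>m. e n m \<in> K \<longrightarrow> m < b" for n
  proof -
    have "inj (e n)" using e_inject by (auto intro: injI)
    moreover have "finite (e n ` {m. e n m \<in> K})"
      by (rule finite_subset[OF _ compactin_level_finite[OF assms, of n]]) auto
    ultimately have "finite {m. e n m \<in> K}" by (metis finite_imageD inj_on_subset subset_UNIV)
    then obtain b where "{m. e n m \<in> K} \<subseteq> {..<b}" using finite_nat_bounded by blast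
    then show ?thesis by blast
  qed
  then show thesis using that by metis
qed

text \<open>Boxes are compact by \<open>compactin_box\<close>, and every compact set lies in one by
  \<open>compactin_box_bound\<close>. Hence the compact sets in \<open>openin_Ck2\<close> can be
  replaced by functions \<open>k\<close>.\<close>

lemma openin_Ck2_boxes:
  "openin (Ck2 X) W \<longleftrightarrow> W \<subseteq> CF \<and> (\<forall>f\<in>W. \<exists>k. \<forall>g\<in>CF. agree f k g \<longrightarrow> g \<in> W)"
proof (intro iffI conjI ballI)
  assume W: "openin (Ck2 X) W"
  then show "W \<subseteq> CF" using openin_subset by fastforce
  fix f assume "f \<in> W"
  with W obtain K where K: "compactin X K" "{g \<in> CF. \<forall>x\<in>K. g x = f x} \<subseteq> W"
    by (rule openin_Ck2E)
  obtain k where k: "\<And>n m. e n m \<in> K \<Longrightarrow> m < k n" using compactin_box_bound[OF K(1)] by metis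
  have "g x = f x" if "agree f k g" "x \<in> K" for g x
  proof -
    have "x \<in> topspace X" using compactin_subset_topspace[OF K(1)] that(2) by blast
    then show ?thesis
      by (cases rule: point_cases) (use that k in \<open>auto simp: agree_def\<close>)
  qed
  then show "\<exists>k. \<forall>g\<in>CF. agree f k g \<longrightarrow> g \<in> W" using K(2) by blast
next
  assume R: "W \<subseteq> CF \<and> (\<forall>f\<in>W. \<exists>k. \<forall>g\<in>CF. agree f k g \<longrightarrow> g \<in> W)"
  show "openin (Ck2 X) W"
    unfolding openin_Ck2
  proof (intro conjI ballI)
    show "W \<subseteq> CF" using R by blast
    fix f assume "f \<in> W"
    then obtain k where k: "\<And>g. g \<in> CF \<Longrightarrow> agree f k g \<Longrightarrow> g \<in> W" using R by blast
    have "agree f k g" if "\<forall>x\<in>D \<union> {e n m |n m. m < k n}. g x = f x" for g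
      unfolding agree_def using that by blast
    then show "\<exists>K. compactin X K \<and> {g \<in> CF. \<forall>x\<in>K. g x = f x} \<subseteq> W"
      using compactin_box k by (intro exI[of _ "D \<union> {e n m |n m. m < k n}"]) blast
  qed
qed

text \<open>To separate \<open>f\<close> from a sequentially closed set \<open>A\<close>, the numbers \<open>k n\<close> of points at level
  \<open>n\<close> at which agreement with \<open>f\<close> is demanded are chosen one after the other. If no number of
  points sufficed at some level, a diagonal argument would produce a convergent sequence
  in \<open>A\<close> whose limit agrees with \<open>f\<close> on this whole level.\<close>

lemma agree_step:
  assumes A: "A \<subseteq> CF" and f: "f \<in> CF"
    and seq: "\<And>\<sigma> l. range \<sigma> \<subseteq> A \<Longrightarrow> limitin (Ck2 X) \<sigma> l sequentially \<Longrightarrow> l \<in> A"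
    and none: "\<And>g. g \<in> A \<Longrightarrow> agree f k g \<Longrightarrow> \<exists>i\<ge>n. \<exists>m. g (e i m) \<noteq> f (e i m)"
  shows "\<exists>b. \<forall>g\<in>A. agree f (k(n := b)) g \<longrightarrow> (\<exists>i\<ge>Suc n. \<exists>m. g (e i m) \<noteq> f (e i m))"
proof (rule ccontr)
  assume "\<not> ?thesis"
  then have "\<forall>b. \<exists>g. g \<in> A \<and> agree f (k(n := b)) g \<and> (\<forall>i\<ge>Suc n. \<forall>m. g (e i m) = f (e i m))"
    by blast
  \<comment> \<open>\<open>G b\<close> equals \<open>f\<close> on \<open>D\<close>, on the first
    \<open>b\<close> points of level \<open>n\<close> and on all later levels, so only levels up to
    \<open>n\<close> are left to vary.\<close>
  then obtain G where G: "\<And>b. G b \<in> A" "\<And>b. agree f (k(n := b)) (G b)"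
    "\<And>b i m. i \<ge> Suc n \<Longrightarrow> G b (e i m) = f (e i m)"
    by metis
  have GCF: "G b \<in> CF" for b using G(1) A by blast
  define E where "E p = e (fst (prod_decode p)) (snd (prod_decode p))" for p
  have "finite (range (\<lambda>j. G j (E p)))" for p
    by (rule finite_subset[of _ "{0, 1}"])
      (use continuous_functions_Z2_values[OF GCF e_in(1)] in \<open>auto simp: E_def\<close>)
  then obtain r where r: "strict_mono r"
    "\<And>p. \<exists>v. \<forall>\<^sub>F j in sequentially. G (r j) (E p) = v"
    using finitely_valued_convergent_subsequence[of "\<lambda>j p. G j (E p)"] by metis
  have GD: "G b x = f x" if "x \<in> D" for b x using G(2)[of b] that by (simp add: agree_def)
  have "\<exists>v. \<forall>\<^sub>F j in sequentially. G (r j) x = v" if "x \<in> topspace X" for x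
    using that
  proof (cases rule: point_cases)
    case derived
    then show ?thesis using GD by auto
  next
    case (isolated n m)
    then show ?thesis using r(2)[of "prod_encode (n, m)"] by (simp add: E_def)
  qed
  then obtain v where v: "\<And>x. x \<in> topspace X \<Longrightarrow> \<forall>\<^sub>F j in sequentially. G (r j) x = v x"
    by metis
  have v_eqI: "v x = c" if "x \<in> topspace X" "\<forall>\<^sub>F j in sequentially. G (r j) x = c" for x c
  proof -
    have "\<forall>\<^sub>F j in sequentially. v x = c"
      using v[OF that(1)] that(2) by eventually_elim simp
    then show ?thesis by simp
  qed
  define g where "g = restrict v (topspace X)"
  have gD: "g x = f x" if "x \<in> D" for x
    using that D_subset GD[OF that] v_eqI[of x "f x"] by (auto simp: g_def)
  have g_tail: "g (e i m) = f (e i m)" if "i \<ge> Suc n" for i m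
    using v_eqI[OF e_in(1), of i m "f (e i m)"] G(3)[OF that] e_in(1) by (simp add: g_def)
  have g01: "g x \<in> {0, 1}" if x: "x \<in> topspace X" for x
  proof -
    obtain j where "G (r j) x = v x" using eventually_happens[OF v[OF x]] by auto
    then show ?thesis using continuous_functions_Z2_values[OF GCF x, of "r j"] x by (auto simp: g_def)
  qed
  \<comment> \<open>A pointwise limit need not be continuous; this one is, as it equals
    \<open>f\<close> on \<open>D\<close> and on all levels after \<open>n\<close>.\<close>
  have g: "g \<in> CF"
    by (rule CF_modify[OF f _ g01 gD g_tail]) (simp_all only: g_def restrict_extensional)
  have "limitin (Ck2 X) (\<lambda>j. G (r j)) g sequentially"
    unfolding limitin_Ck2
  proof (intro conjI allI impI g)
    fix K assume K: "compactin X K"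
    \<comment> \<open>Everywhere else on \<open>K\<close> the functions \<open>G (r j)\<close>
      already equal the limit, so convergence has to be awaited at finitely many points
      only.\<close>
    let ?F = "\<Union>i\<le>n. K \<inter> range (e i)"
    have "\<forall>\<^sub>F j in sequentially. \<forall>x\<in>?F. G (r j) x = v x"
    proof (rule eventually_ball_finite)
      show "finite ?F" by (rule finite_UN_I) (use compactin_level_finite[OF K] in auto)
      show "\<forall>x\<in>?F. \<forall>\<^sub>F j in sequentially. G (r j) x = v x"
        using v compactin_subset_topspace[OF K] by blast
    qed
    then show "\<forall>\<^sub>F j in sequentially. G (r j) \<in> CF \<and> (\<forall>x\<in>K. G (r j) x = g x)"
    proof eventually_elim
      case (elim j)
      have "G (r j) x = g x" if x: "x \<in> K" for x
      proof -
        have xX: "x \<in> topspace X" using x compactin_subset_topspace[OF K] by blast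
        then show ?thesis
        proof (cases rule: point_cases)
          case derived
          then show ?thesis using GD gD by simp
        next
          case (isolated i m)
          show ?thesis
          proof (cases "i \<le> n")
            case True
            then have "x \<in> ?F" using x isolated by blast
            then show ?thesis using elim xX by (simp add: g_def)
          next
            case False
            then show ?thesis using G(3) g_tail isolated by simp
          qed
        qed
      qed
      then show ?case using GCF by blast
    qed
  qed
  then have "g \<in> A" using seq[of "\<lambda>j. G (r j)"] G(1) by blast
  moreover have g_level: "g (e n m) = f (e n m)" for m
  proof -
    have "G (r j) (e n m) = f (e n m)" if "j \<ge> Suc m" for j
      using G(2)[of "r j"] seq_suble[OF r(1), of j] that by (simp add: agree_def)
    then have "\<forall>\<^sub>F j in sequentially. G (r j) (e n m) = f (e n m)"
      unfolding eventually_sequentially by blast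
    then show ?thesis using v_eqI[OF e_in(1)] e_in(1) by (simp add: g_def)
  qed
  moreover have "agree f k g"
    unfolding agree_def
  proof (intro conjI ballI allI impI)
    show "g x = f x" if "x \<in> D" for x using that by (rule gD)
    fix i m assume m: "m < k i"
    show "g (e i m) = f (e i m)"
    proof (cases "i = n")
      case True
      then show ?thesis using g_level by simp
    next
      case False
      then have "G b (e i m) = f (e i m)" for b using G(2)[of b] m by (simp add: agree_def)
      then show ?thesis using v_eqI[OF e_in(1)] e_in(1) by (simp add: g_def)
    qed
  qed
  moreover have "g (e i m) = f (e i m)" if "i \<ge> n" for i m
    using that g_level g_tail[of i m] by (cases "i = n") auto
  ultimately show False using none by blast
qed

text \<open>For \<open>f\<close> outside a sequentially closed \<open>A\<close>, the numbers
  \<open>k n\<close> are fixed so that at no stage a \<open>g\<close> in \<open>A\<close> satisfying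
  the demands equals \<open>f\<close> on all remaining levels. Each continuous \<open>g\<close> that
  agrees with \<open>f\<close> on \<open>D\<close> does equal \<open>f\<close> from some level on,
  so all demands together exclude \<open>A\<close>.\<close>

lemma sequential_space_Ck2: "sequential_space (Ck2 X)"
  unfolding sequential_space_iff
proof (intro allI impI)
  fix A assume A: "A \<subseteq> topspace (Ck2 X)"
    and seq: "\<forall>\<sigma> l. range \<sigma> \<subseteq> A \<and> limitin (Ck2 X) \<sigma> l sequentially \<longrightarrow> l \<in> A"
  have ACF: "A \<subseteq> CF" using A by simp
  have "\<exists>k. \<forall>g\<in>CF. agree f k g \<longrightarrow> g \<in> CF - A" if f: "f \<in> CF - A" for f
  proof -
    let ?P = "\<lambda>n k. \<forall>g\<in>A. agree f k g \<longrightarrow> (\<exists>i\<ge>n. \<exists>m. g (e i m) \<noteq> f (e i m))"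
    have "?P 0 k" for k
    proof (rule ballI, rule impI, rule ccontr)
      fix g assume g: "g \<in> A" "agree f k g" "\<not> (\<exists>i\<ge>0. \<exists>m. g (e i m) \<noteq> f (e i m))"
      have "g x = f x" if "x \<in> topspace X" for x
        using that by (cases rule: point_cases) (use g in \<open>auto simp: agree_def\<close>)
      then have "g = f" using g(1) f ACF by (intro continuous_functions_Z2_eqI[of g X f]) auto
      then show False using g(1) f by simp
    qed
    then have base: "\<exists>k. ?P 0 k" by (rule exI)
    have step: "\<exists>k'. ?P (Suc n) k' \<and> (\<forall>i. i \<noteq> n \<longrightarrow> k' i = k i)" if k: "?P n k" for n k
    proof -
      obtain b where "\<forall>g\<in>A. agree f (k(n := b)) g \<longrightarrow> (\<exists>i\<ge>Suc n. \<exists>m. g (e i m) \<noteq> f (e i m))"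
        using agree_step[of A f k n] ACF f seq k by blast
      then show ?thesis by (intro exI[of _ "k(n := b)"]) simp
    qed
    have "\<exists>kk. \<forall>n. ?P n (kk n) \<and> (\<forall>i. i \<noteq> n \<longrightarrow> kk (Suc n) i = kk n i)"
      by (rule dependent_nat_choice[of ?P "\<lambda>n k k'. \<forall>i. i \<noteq> n \<longrightarrow> k' i = k i", OF base step])
    then obtain kk where kk: "\<And>n. ?P n (kk n)" "\<And>n i. i \<noteq> n \<Longrightarrow> kk (Suc n) i = kk n i"
      by metis
    \<comment> \<open>Step \<open>n\<close> alters only the entry at \<open>n\<close>, so entry
      \<open>i\<close> has its final value from stage \<open>i + 1\<close> on.\<close>
    define k where "k i = kk (Suc i) i" for i
    have k: "kk n i = (if i < n then k i else kk 0 i)" for n i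
      by (induction n) (auto simp: kk(2) k_def less_Suc_eq)
    \<comment> \<open>Stage \<open>N\<close> still has its initial entries at the levels from
      \<open>N\<close> on; the maximum makes agreement along \<open>?k\<close> imply agreement along
      every \<open>kk N\<close>.\<close>
    let ?k = "\<lambda>i. max (k i) (kk 0 i)"
    have "g \<in> CF - A" if g: "g \<in> CF" "agree f ?k g" for g
    proof (rule ccontr)
      assume "g \<notin> CF - A"
      then have gA: "g \<in> A" using g by blast
      obtain N where "\<forall>i\<ge>N. \<forall>m. g (e i m) = f (e i m)"
        using CF_eventually_agree[of f g] f g by (auto simp: agree_def)
      moreover have "agree f (kk N) g" using g(2) k[of N] by (auto simp: agree_def)
      ultimately show False using kk(1) gA by blast
    qed
    then show ?thesis by blast
  qed
  then have "openin (Ck2 X) (CF - A)" unfolding openin_Ck2_boxes by blast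
  then show "closedin (Ck2 X) A" using A by (simp add: closedin_def)
qed

end

section \<open>The direct power of the Cantor group\<close>

lemma bit_add_cancel:
  fixes a b c :: int
  assumes "a \<in> {0, 1}" "b \<in> {0, 1}" "c \<in> {0, 1}"
  shows "(a + c) mod 2 = (b + c) mod 2 \<longleftrightarrow> a = b" "((a + c) mod 2 + c) mod 2 = a"
    "(c + (c + a) mod 2) mod 2 = a"
  using assms by auto

lemma bit_add_closed: "(a + b :: int) mod 2 \<in> {0, 1}"
  by auto

lemma group_Cantor_group: "group Cantor_group"
  by simp

lemma carrier_Cantor_group: "carrier Cantor_group = {v. \<forall>m. v m \<in> {0, 1}}"
  by (auto simp: carrier_Z2 PiE_iff)

lemma one_Cantor_group: "\<one>\<^bsub>Cantor_group\<^esub> = (\<lambda>_. 0)"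
  by (simp add: restrict_def)

lemma mult_Cantor_group: "u \<otimes>\<^bsub>Cantor_group\<^esub> v = (\<lambda>m. (u m + v m) mod 2)"
  by (simp add: product_group_def restrict_def)

abbreviation (input) Cantor_sum :: "(nat \<Rightarrow> nat \<Rightarrow> int) set" where
  "Cantor_sum \<equiv> carrier (direct_power Cantor_group)"

abbreviation (input) Cantor_sum_topology :: "(nat \<Rightarrow> nat \<Rightarrow> int) topology" where
  "Cantor_sum_topology \<equiv> direct_power_topology Cantor_group Cantor_topology"

lemma carrier_direct_power_Cantor:
  "Cantor_sum = {s. (\<forall>n m. s n m \<in> {0, 1}) \<and> finite {n. s n \<noteq> (\<lambda>_. 0)}}"
  unfolding carrier_direct_power[OF group_Cantor_group] one_Cantor_group carrier_Cantor_group by auto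

lemma direct_power_Cantor_bit: "s \<in> Cantor_sum \<Longrightarrow> s n m \<in> {0, 1}"
  unfolding carrier_direct_power_Cantor by blast

lemma mult_direct_power_Cantor:
  "s \<otimes>\<^bsub>direct_power Cantor_group\<^esub> t = (\<lambda>n m. (s n m + t n m) mod 2)"
  by (simp only: mult_direct_power mult_Cantor_group)

lemma direct_power_Cantor_add:
  assumes "s \<in> Cantor_sum" "t \<in> Cantor_sum"
  shows "(\<lambda>n m. (s n m + t n m) mod 2) \<in> Cantor_sum"
proof -
  have "{n. (\<lambda>m. (s n m + t n m) mod 2) \<noteq> (\<lambda>_. 0)} \<subseteq> {n. s n \<noteq> (\<lambda>_. 0)} \<union> {n. t n \<noteq> (\<lambda>_. 0)}"
    by auto
  then have "finite {n. (\<lambda>m. (s n m + t n m) mod 2) \<noteq> (\<lambda>_. 0)}"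
    by (rule finite_subset) (use assms in \<open>simp add: carrier_direct_power_Cantor\<close>)
  then show ?thesis unfolding carrier_direct_power_Cantor using bit_add_closed by blast
qed

lemma Cantor_topology_nhd:
  assumes "openin Cantor_topology U" "u \<in> U"
  shows "\<exists>k. \<forall>v. (\<forall>m. v m \<in> {0, 1}) \<and> (\<forall>m<k. v m = u m) \<longrightarrow> v \<in> U"
proof -
  obtain B where B: "finite {m \<in> UNIV. B m \<noteq> topspace Z2_topology}" "u \<in> Pi\<^sub>E UNIV B" "Pi\<^sub>E UNIV B \<subseteq> U"
    using assms unfolding openin_product_topology_alt by meson
  obtain k where k: "{m \<in> UNIV. B m \<noteq> topspace Z2_topology} \<subseteq> {..<k}"
    using finite_nat_bounded[OF B(1)] by blast
  have "v \<in> U" if v: "\<And>m. v m \<in> {0, 1}" "\<And>m. m < k \<Longrightarrow> v m = u m" for v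
  proof -
    have "v m \<in> B m" for m
    proof (cases "m < k")
      case True
      then show ?thesis using v(2) PiE_mem[OF B(2), of m] by simp
    next
      case False
      then have "B m = {0, 1}" using k by (auto simp: carrier_Z2)
      then show ?thesis using v(1) by simp
    qed
    then show ?thesis using B(3) by (auto simp: PiE_iff)
  qed
  then show ?thesis by blast
qed

lemma openin_Cantor_cylinder:
  "openin Cantor_topology {v. (\<forall>m. v m \<in> {0, 1}) \<and> (\<forall>m<k. v m = 0)}"
proof -
  let ?B = "\<lambda>m::nat. if m < k then {0} else {0, 1::int}"
  have B: "v m \<in> ?B m \<longleftrightarrow> v m \<in> {0, 1} \<and> (m < k \<longrightarrow> v m = 0)" for v m
    by auto
  have "{v. (\<forall>m. v m \<in> {0, 1}) \<and> (\<forall>m<k. v m = 0)} = Pi\<^sub>E UNIV ?B"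
    unfolding set_eq_iff PiE_iff B mem_Collect_eq extensional_UNIV by blast
  moreover have "openin Cantor_topology (Pi\<^sub>E UNIV ?B)"
    unfolding openin_PiE_gen
  proof (intro disjI2 conjI ballI)
    show "finite {m \<in> UNIV. ?B m \<noteq> topspace Z2_topology}"
      by (rule finite_subset[of _ "{..<k}"]) (auto simp: carrier_Z2)
  qed (auto simp: carrier_Z2)
  ultimately show ?thesis by simp
qed

text \<open>Boxes can be refined to products of cylinders that fix the first \<open>k n\<close> bits
  in factor \<open>n\<close>. This describes open sets by functions \<open>k\<close> exactly as
  \<open>openin_Ck2_boxes\<close> does, so that later homeomorphisms reduce to comparing
  bits.\<close>

lemma openin_direct_power_Cantor:
  "openin Cantor_sum_topology W \<longleftrightarrow> W \<subseteq> Cantor_sum \<and>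
     (\<forall>s\<in>W. \<exists>k. \<forall>t\<in>Cantor_sum. (\<forall>n. \<forall>m<k n. t n m = s n m) \<longrightarrow> t \<in> W)"
  unfolding openin_direct_power_topology
proof (intro conj_cong refl ball_cong iffI)
  fix s assume W: "W \<subseteq> Cantor_sum" and "s \<in> W"
  then have s: "s \<in> Cantor_sum" by blast
  {
    assume "\<exists>U. (\<forall>n. openin Cantor_topology (U n) \<and> \<one>\<^bsub>Cantor_group\<^esub> \<in> U n) \<and>
      s <#\<^bsub>direct_power Cantor_group\<^esub> box_nhd Cantor_group U \<subseteq> W"
    then obtain U where U: "\<And>n. openin Cantor_topology (U n)" "\<And>n. (\<lambda>_. 0) \<in> U n"
      "s <#\<^bsub>direct_power Cantor_group\<^esub> box_nhd Cantor_group U \<subseteq> W"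
      unfolding one_Cantor_group by blast
    have "\<exists>k. \<forall>v. (\<forall>m. v m \<in> {0, 1}) \<and> (\<forall>m<k. v m = 0) \<longrightarrow> v \<in> U n" for n
      using Cantor_topology_nhd[OF U(1,2)] by simp
    then obtain k where k: "\<And>n v. (\<And>m. v m \<in> {0, 1}) \<Longrightarrow> (\<And>m. m < k n \<Longrightarrow> v m = 0) \<Longrightarrow> v \<in> U n"
      by metis
    have "t \<in> W" if t: "t \<in> Cantor_sum" "\<forall>n. \<forall>m<k n. t n m = s n m" for t
    proof -
      \<comment> \<open>The group has exponent 2, so the sum is also the difference, and
        \<open>t\<close> is the translate of \<open>?u\<close> by \<open>s\<close>.\<close>
      let ?u = "\<lambda>n m. (s n m + t n m) mod 2"
      have "?u n \<in> U n" for n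
      proof (rule k)
        show "?u n m = 0" if "m < k n" for m
          using that t(2) by simp
      qed auto
      then have "?u \<in> box_nhd Cantor_group U"
        unfolding box_nhd_def using direct_power_Cantor_add[OF s t(1)] by (simp add: PiE_iff)
      moreover have "t = s \<otimes>\<^bsub>direct_power Cantor_group\<^esub> ?u"
        unfolding mult_direct_power_Cantor
        using bit_add_cancel(3)[OF direct_power_Cantor_bit[OF t(1)] _ direct_power_Cantor_bit[OF s]]
          direct_power_Cantor_bit[OF s] by (intro ext) metis
      ultimately show ?thesis using U(3) unfolding l_coset_def by blast
    qed
    then show "\<exists>k. \<forall>t\<in>Cantor_sum. (\<forall>n. \<forall>m<k n. t n m = s n m) \<longrightarrow> t \<in> W" by blast
  }
  {
    assume "\<exists>k. \<forall>t\<in>Cantor_sum. (\<forall>n. \<forall>m<k n. t n m = s n m) \<longrightarrow> t \<in> W"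
    then obtain k where k: "\<And>t. t \<in> Cantor_sum \<Longrightarrow> (\<And>n m. m < k n \<Longrightarrow> t n m = s n m) \<Longrightarrow> t \<in> W" by blast
    define U where "U n = {v. (\<forall>m. v m \<in> {0, 1::int}) \<and> (\<forall>m<k n. v m = 0)}" for n
    have "s <#\<^bsub>direct_power Cantor_group\<^esub> box_nhd Cantor_group U \<subseteq> W"
    proof
      fix t assume "t \<in> s <#\<^bsub>direct_power Cantor_group\<^esub> box_nhd Cantor_group U"
      then obtain u where u: "u \<in> box_nhd Cantor_group U" "t = (\<lambda>n m. (s n m + u n m) mod 2)"
        unfolding l_coset_def mult_direct_power_Cantor by blast
      have uS: "u \<in> Cantor_sum" and uU: "\<And>n. u n \<in> U n" using u(1) by (auto simp: box_nhd_def PiE_iff)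
      show "t \<in> W"
      proof (rule k)
        show "t \<in> Cantor_sum" unfolding u(2) using s uS by (rule direct_power_Cantor_add)
        fix n m assume "m < k n"
        then have "u n m = 0" using uU[of n] by (simp add: U_def)
        then show "t n m = s n m" using direct_power_Cantor_bit[OF s, of n m] by (auto simp: u(2))
      qed
    qed
    moreover have "openin Cantor_topology (U n) \<and> \<one>\<^bsub>Cantor_group\<^esub> \<in> U n" for n
      unfolding U_def one_Cantor_group using openin_Cantor_cylinder by simp
    ultimately show "\<exists>U. (\<forall>n. openin Cantor_topology (U n) \<and> \<one>\<^bsub>Cantor_group\<^esub> \<in> U n) \<and>
      s <#\<^bsub>direct_power Cantor_group\<^esub> box_nhd Cantor_group U \<subseteq> W" by blast
  }
qed

lemma openin_direct_power_CantorE: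
  assumes "openin Cantor_sum_topology W" "s \<in> W"
  obtains k where "\<And>t. t \<in> Cantor_sum \<Longrightarrow> \<forall>n. \<forall>m<k n. t n m = s n m \<Longrightarrow> t \<in> W"
proof -
  have "\<exists>k. \<forall>t\<in>Cantor_sum. (\<forall>n. \<forall>m<k n. t n m = s n m) \<longrightarrow> t \<in> W"
    by (rule bspec[OF conjunct2[OF assms(1)[unfolded openin_direct_power_Cantor]] assms(2)])
  then obtain k where k: "\<forall>t\<in>Cantor_sum. (\<forall>n. \<forall>m<k n. t n m = s n m) \<longrightarrow> t \<in> W" ..
  show thesis by (rule that[of k]) (use k in blast)
qed

lemma topspace_direct_power_Cantor: "topspace Cantor_sum_topology = Cantor_sum"
proof (rule antisym)
  show "topspace Cantor_sum_topology \<subseteq> Cantor_sum" using openin_topspace[of Cantor_sum_topology] unfolding openin_direct_power_Cantor by blast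
  have "openin Cantor_sum_topology Cantor_sum" unfolding openin_direct_power_Cantor by blast
  then show "Cantor_sum \<subseteq> topspace Cantor_sum_topology" by (rule openin_subset)
qed

section \<open>Spaces that split into clopen copies of one space\<close>

text \<open>The fibres of \<open>q\<close> are open, because its target is discrete. Pairing the
  label \<open>q z\<close> with the chart of its fibre gives a map whose continuity and openness can
  be checked fibre by fibre.\<close>

lemma homeomorphic_space_fibres:
  assumes q: "continuous_map Z (discrete_topology I) q"
    and c: "\<And>i. i \<in> I \<Longrightarrow> homeomorphic_map (subtopology Z {z \<in> topspace Z. q z = i}) S (c i)"
  shows "Z homeomorphic_space prod_topology (discrete_topology I) S"
proof -
  let ?Z = "\<lambda>i. {z \<in> topspace Z. q z = i}"
  let ?h = "\<lambda>z. (q z, c (q z) z)"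
  have qI: "q z \<in> I" if "z \<in> topspace Z" for z
    using continuous_map_image_subset_topspace[OF q] that by auto
  have opZ: "openin Z (?Z i)" if "i \<in> I" for i
    using openin_continuous_map_preimage[OF q, of "{i}"] that by simp
  have topZ: "topspace (subtopology Z (?Z i)) = ?Z i" for i by auto
  have c_bij: "bij_betw (c i) (?Z i) (topspace S)" if "i \<in> I" for i
    using homeomorphic_imp_injective_map[OF c[OF that]]
      homeomorphic_imp_surjective_map[OF c[OF that]] unfolding topZ bij_betw_def by blast
  have "homeomorphic_map Z (prod_topology (discrete_topology I) S) ?h"
  proof (rule bijective_open_imp_homeomorphic_map)
    have "continuous_map Z S (\<lambda>z. c (q z) z)"
      unfolding continuous_map_def
    proof (intro conjI allI impI)
      show "(\<lambda>z. c (q z) z) \<in> topspace Z \<rightarrow> topspace S"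
        using c_bij qI by (auto dest!: bij_betwE)
      fix U assume U: "openin S U"
      have "openin Z {z \<in> ?Z i. c i z \<in> U}" if "i \<in> I" for i
        using openin_continuous_map_preimage[OF homeomorphic_imp_continuous_map[OF c[OF that]] U]
        unfolding topZ openin_open_subtopology[OF opZ[OF that]] by blast
      then have "openin Z (\<Union>i\<in>I. {z \<in> ?Z i. c i z \<in> U})" by blast
      moreover have "{z \<in> topspace Z. c (q z) z \<in> U} = (\<Union>i\<in>I. {z \<in> ?Z i. c i z \<in> U})"
        using qI by auto
      ultimately show "openin Z {z \<in> topspace Z. c (q z) z \<in> U}" by simp
    qed
    with q show "continuous_map Z (prod_topology (discrete_topology I) S) ?h"
      by (rule continuous_map_pairedI)
    show "?h ` topspace Z = topspace (prod_topology (discrete_topology I) S)"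
    proof
      show "?h ` topspace Z \<subseteq> topspace (prod_topology (discrete_topology I) S)"
        using c_bij qI by (auto dest!: bij_betwE)
      show "topspace (prod_topology (discrete_topology I) S) \<subseteq> ?h ` topspace Z"
      proof
        fix p assume "p \<in> topspace (prod_topology (discrete_topology I) S)"
        then obtain i s where p: "p = (i, s)" "i \<in> I" "s \<in> topspace S" by auto
        have "s \<in> c i ` ?Z i" using bij_betw_imp_surj_on[OF c_bij[OF p(2)]] p(3) by simp
        then obtain z where z: "z \<in> topspace Z" "q z = i" "c i z = s" by auto
        then have "p = ?h z" using p(1) by simp
        then show "p \<in> ?h ` topspace Z" using z(1) by (rule image_eqI)
      qed
    qed
    show "inj_on ?h (topspace Z)"
    proof (rule inj_onI)
      fix z z' assume z: "z \<in> topspace Z" "z' \<in> topspace Z" "?h z = ?h z'"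
      then show "z = z'"
        using inj_onD[OF bij_betw_imp_inj_on[OF c_bij[OF qI[OF z(1)]]], of z z'] by auto
    qed
    show "open_map Z (prod_topology (discrete_topology I) S) ?h"
      unfolding open_map_def
    proof (intro allI impI)
      fix W assume W: "openin Z W"
      have "openin (prod_topology (discrete_topology I) S) ({i} \<times> c i ` (W \<inter> ?Z i))" if i: "i \<in> I" for i
      proof -
        have "openin (subtopology Z (?Z i)) (W \<inter> ?Z i)" using W by (rule openin_subtopology_Int)
        then have "openin S (c i ` (W \<inter> ?Z i))"
          using homeomorphic_imp_open_map[OF c[OF i]] unfolding open_map_def by blast
        then show ?thesis using i by (simp add: openin_prod_Times_iff)
      qed
      then have "openin (prod_topology (discrete_topology I) S) (\<Union>i\<in>I. {i} \<times> c i ` (W \<inter> ?Z i))"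
        by blast
      moreover have "?h ` W = (\<Union>i\<in>I. {i} \<times> c i ` (W \<inter> ?Z i))"
        using qI openin_subset[OF W] by auto
      ultimately show "openin (prod_topology (discrete_topology I) S) (?h ` W)" by simp
    qed
  qed
  then show ?thesis by (rule homeomorphic_map_imp_homeomorphic_space)
qed

lemma homeomorphic_space_prod_topology_assoc:
  "prod_topology X (prod_topology Y Z) homeomorphic_space prod_topology (prod_topology X Y) Z"
  unfolding homeomorphic_space_def homeomorphic_maps_def
proof (intro exI conjI ballI)
  show "continuous_map (prod_topology X (prod_topology Y Z)) (prod_topology (prod_topology X Y) Z)
      (\<lambda>p. ((fst p, (fst \<circ> snd) p), (snd \<circ> snd) p))"
    by (intro continuous_map_pairedI continuous_map_fst continuous_map_snd
        continuous_map_compose[OF continuous_map_snd] continuous_map_compose[OF continuous_map_fst])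
  show "continuous_map (prod_topology (prod_topology X Y) Z) (prod_topology X (prod_topology Y Z))
      (\<lambda>p. ((fst \<circ> fst) p, ((snd \<circ> fst) p, snd p)))"
    by (intro continuous_map_pairedI continuous_map_fst continuous_map_snd
        continuous_map_compose[OF continuous_map_snd] continuous_map_compose[OF continuous_map_fst])
qed auto

lemma homeomorphic_space_discrete_topology:
  assumes "bij_betw h A B"
  shows "discrete_topology A homeomorphic_space discrete_topology B"
  unfolding homeomorphic_space_def homeomorphic_maps_def
  using assms bij_betw_inv_into[OF assms]
  by (intro exI[of _ h] exI[of _ "inv_into A h"])
    (auto simp: bij_betw_inv_into_left bij_betw_inv_into_right dest: bij_betwE)

text \<open>\<open>Z\<close> is \<open>I\<close> copies of \<open>S\<close>, hence
  \<open>I \<times> J\<close> copies, hence \<open>J\<close> copies, hence \<open>S\<close>; the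
  sets \<open>I \<times> J\<close> and \<open>J\<close> are both countably infinite.\<close>

lemma homeomorphic_space_absorb_discrete:
  assumes Z: "Z homeomorphic_space prod_topology (discrete_topology I) S"
    and S: "S homeomorphic_space prod_topology (discrete_topology J) S"
    and I: "countable I" "I \<noteq> {}" and J: "countable J" "infinite J"
  shows "Z homeomorphic_space S"
proof -
  have "countable (I \<times> J)" "infinite (I \<times> J)" using I J by (auto simp: finite_cartesian_product_iff)
  then have "bij_betw (from_nat_into J \<circ> to_nat_on (I \<times> J)) (I \<times> J) J"
    using to_nat_on_infinite bij_betw_from_nat_into[OF J] bij_betw_trans by blast
  then have IJ: "discrete_topology (I \<times> J) homeomorphic_space discrete_topology J"
    by (rule homeomorphic_space_discrete_topology)
  note Z
  also have "prod_topology (discrete_topology I) S homeomorphic_space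
      prod_topology (discrete_topology I) (prod_topology (discrete_topology J) S)"
    by (rule homeomorphic_space_prod_topology[OF homeomorphic_space_refl S])
  also have "\<dots> homeomorphic_space prod_topology (discrete_topology (I \<times> J)) S"
    unfolding prod_topology_discrete_topology by (rule homeomorphic_space_prod_topology_assoc)
  also have "\<dots> homeomorphic_space prod_topology (discrete_topology J) S"
    by (rule homeomorphic_space_prod_topology[OF IJ homeomorphic_space_refl])
  also have "\<dots> homeomorphic_space S"
    by (rule homeomorphic_space_sym[THEN iffD1, OF S])
  finally show ?thesis .
qed

text \<open>The pieces are given by the finitely many \<open>n\<close> for which the bit \<open>s n 0\<close> is set.\<close>

lemma direct_power_Cantor_split:
  "Cantor_sum_topology homeomorphic_space prod_topology (discrete_topology {F :: nat set. finite F}) Cantor_sum_topology"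
proof (rule homeomorphic_space_fibres)
  let ?q = "\<lambda>s :: nat \<Rightarrow> nat \<Rightarrow> int. {n. s n 0 \<noteq> 0}"
  \<comment> \<open>Deleting bit 0 of each row identifies every piece with the whole space. The
    inverse restores the bits prescribed by \<open>F\<close>, and finiteness of \<open>F\<close>
    keeps almost all rows zero.\<close>
  let ?c = "\<lambda>s :: nat \<Rightarrow> nat \<Rightarrow> int. (\<lambda>n m. s n (Suc m))"
  have q_fin: "finite (?q s)" if "s \<in> Cantor_sum" for s
    by (rule finite_subset[of _ "{n. s n \<noteq> (\<lambda>_. 0)}"]) (use that in \<open>auto simp: carrier_direct_power_Cantor\<close>)
  show "continuous_map Cantor_sum_topology (discrete_topology {F :: nat set. finite F}) ?q"
    unfolding continuous_map_def
  proof (intro conjI allI impI)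
    show "?q \<in> topspace Cantor_sum_topology \<rightarrow> topspace (discrete_topology {F :: nat set. finite F})"
      using q_fin by (auto simp: topspace_direct_power_Cantor)
    fix U :: "nat set set"
    have "?q t = ?q s" if "\<forall>n. \<forall>m<Suc 0. t n m = s n m" for s t
      using that by simp
    then show "openin Cantor_sum_topology {s \<in> topspace Cantor_sum_topology. ?q s \<in> U}"
      unfolding openin_direct_power_Cantor topspace_direct_power_Cantor
      by (intro conjI ballI exI[of _ "\<lambda>_. Suc 0"]) auto
  qed
  fix F :: "nat set" assume "F \<in> {F. finite F}"
  then have F: "finite F" by simp
  let ?S = "{s \<in> topspace Cantor_sum_topology. ?q s = F}"
  have S: "topspace (subtopology Cantor_sum_topology ?S) = ?S" by auto
  have "?q s = F \<longleftrightarrow> (\<forall>n. s n 0 = (if n \<in> F then 1 else 0))" if "s \<in> Cantor_sum" for s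
  proof -
    have "(n \<in> ?q s \<longleftrightarrow> n \<in> F) \<longleftrightarrow> s n 0 = (if n \<in> F then 1 else 0)" for n
      using direct_power_Cantor_bit[OF that, of n 0] by auto
    then show ?thesis unfolding set_eq_iff by simp
  qed
  then have SE: "?S = {s \<in> Cantor_sum. \<forall>n. s n 0 = (if n \<in> F then 1 else 0)}"
    unfolding topspace_direct_power_Cantor by (intro Collect_cong conj_cong refl)
  have cS: "?c s \<in> Cantor_sum" if "s \<in> Cantor_sum" for s
  proof -
    have "finite {n. ?c s n \<noteq> (\<lambda>_. 0)}"
      by (rule finite_subset[of _ "{n. s n \<noteq> (\<lambda>_. 0)}"]) (use that in \<open>auto simp: carrier_direct_power_Cantor\<close>)
    then show ?thesis using that by (simp add: carrier_direct_power_Cantor)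
  qed
  have lift: "\<exists>s\<in>?S. ?c s = t" if t: "t \<in> Cantor_sum" for t
  proof
    let ?s = "\<lambda>n. case_nat (if n \<in> F then 1 else 0) (t n)"
    have "finite {n. ?s n \<noteq> (\<lambda>_. 0)}"
      by (rule finite_subset[of _ "F \<union> {n. t n \<noteq> (\<lambda>_. 0)}"])
        (use t F in \<open>auto simp: carrier_direct_power_Cantor split: nat.splits\<close>)
    then show "?s \<in> ?S"
      unfolding SE using t by (auto simp: carrier_direct_power_Cantor split: nat.splits)
  qed simp
  have S_eq: "t n m = s n m" if "s \<in> ?S" "t \<in> ?S" "0 < m \<Longrightarrow> ?c t n (m - 1) = ?c s n (m - 1)" for s t n m
    using that unfolding SE by (cases m) auto
  have op: "openin Cantor_sum_topology ?S"
    unfolding openin_direct_power_Cantor SE by (auto intro!: exI[of _ "\<lambda>_. 1"])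
  show "homeomorphic_map (subtopology Cantor_sum_topology ?S) Cantor_sum_topology ?c"
  proof (rule bijective_open_imp_homeomorphic_map)
    show "?c ` topspace (subtopology Cantor_sum_topology ?S) = topspace Cantor_sum_topology"
      unfolding S using cS lift by (auto simp: topspace_direct_power_Cantor)
    show "inj_on ?c (topspace (subtopology Cantor_sum_topology ?S))"
    proof (rule inj_onI)
      fix s t assume st: "s \<in> topspace (subtopology Cantor_sum_topology ?S)" "t \<in> topspace (subtopology Cantor_sum_topology ?S)"
        "?c s = ?c t"
      have cst: "?c t n m = ?c s n m" for n m
        using fun_cong[OF fun_cong[OF st(3)], of n m] by simp
      have "t n m = s n m" for n m
        by (rule S_eq[OF st(1,2)[unfolded S] cst])
      then show "s = t" by (intro ext) simp
    qed
    show "continuous_map (subtopology Cantor_sum_topology ?S) Cantor_sum_topology ?c"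
      unfolding continuous_map_def
    proof (intro conjI allI impI)
      show "?c \<in> topspace (subtopology Cantor_sum_topology ?S) \<rightarrow> topspace Cantor_sum_topology"
        unfolding S using cS by (auto simp: topspace_direct_power_Cantor)
      fix U assume U: "openin Cantor_sum_topology U"
      have "openin Cantor_sum_topology {s \<in> ?S. ?c s \<in> U}"
        unfolding openin_direct_power_Cantor
      proof (intro conjI ballI)
        fix s assume s: "s \<in> {s \<in> ?S. ?c s \<in> U}"
        then obtain k where k: "\<And>t. t \<in> Cantor_sum \<Longrightarrow> \<forall>n. \<forall>m<k n. t n m = ?c s n m \<Longrightarrow> t \<in> U"
          using openin_direct_power_CantorE[OF U, of "?c s"] by blast
        \<comment> \<open>\<open>Suc (k n)\<close> compensates for the shift by one bit; it also
          covers bit 0, so that \<open>t\<close> stays in the same piece.\<close>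
        have "t \<in> {s \<in> ?S. ?c s \<in> U}" if t: "t \<in> Cantor_sum" "\<forall>n. \<forall>m<Suc (k n). t n m = s n m" for t
        proof -
          have "?c t \<in> U" by (rule k[OF cS[OF t(1)]]) (use t(2) in auto)
          moreover have "t \<in> ?S" using s t unfolding SE by simp
          ultimately show ?thesis by blast
        qed
        then show "\<exists>k. \<forall>t\<in>Cantor_sum. (\<forall>n. \<forall>m<k n. t n m = s n m) \<longrightarrow> t \<in> {s \<in> ?S. ?c s \<in> U}"
          by (intro exI[of _ "\<lambda>n. Suc (k n)"]) blast
      qed (auto simp: topspace_direct_power_Cantor)
      then show "openin (subtopology Cantor_sum_topology ?S) {s \<in> topspace (subtopology Cantor_sum_topology ?S). ?c s \<in> U}"
        unfolding S openin_open_subtopology[OF op] by blast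
    qed
    show "open_map (subtopology Cantor_sum_topology ?S) Cantor_sum_topology ?c"
      unfolding open_map_def openin_open_subtopology[OF op]
    proof (intro allI impI)
      fix W assume W: "openin Cantor_sum_topology W \<and> W \<subseteq> ?S"
      show "openin Cantor_sum_topology (?c ` W)"
        unfolding openin_direct_power_Cantor
      proof (intro conjI ballI)
        show "?c ` W \<subseteq> Cantor_sum" using W cS by (auto simp: topspace_direct_power_Cantor)
        fix u assume "u \<in> ?c ` W"
        then obtain s where s: "s \<in> W" "u = ?c s" by blast
        then obtain k where k: "\<And>t. t \<in> Cantor_sum \<Longrightarrow> \<forall>n. \<forall>m<k n. t n m = s n m \<Longrightarrow> t \<in> W"
          using openin_direct_power_CantorE[of W s] W by blast
        have "v \<in> ?c ` W" if v: "v \<in> Cantor_sum" "\<forall>n. \<forall>m<k n. v n m = u n m" for v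
        proof -
          obtain t where t: "t \<in> ?S" "?c t = v" using lift[OF v(1)] by blast
          have sS: "s \<in> ?S" using s(1) W by blast
          \<comment> \<open>In this direction \<open>k n\<close> bits are enough: bit 0 is
            prescribed by the piece, and bit \<open>m > 0\<close> is bit \<open>m - 1\<close> of the
            image.\<close>
          have "t n m = s n m" if m: "m < k n" for n m
          proof (rule S_eq[OF sS t(1)])
            assume "0 < m"
            then have "m - 1 < k n" using m by simp
            from v(2)[rule_format, OF this] show "?c t n (m - 1) = ?c s n (m - 1)"
              by (simp only: t(2)[symmetric] s(2))
          qed
          then have "t \<in> W" using k t(1) by (auto simp: topspace_direct_power_Cantor)
          then show ?thesis using t(2) by blast
        qed
        then show "\<exists>k. \<forall>v\<in>Cantor_sum. (\<forall>n. \<forall>m<k n. v n m = u n m) \<longrightarrow> v \<in> ?c ` W" by blast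
      qed
    qed
  qed
qed

section \<open>Cosets of the functions vanishing on the derived set\<close>

lemma carrier_Ck2_group: "carrier (Ck2_group X) = continuous_functions X Z2_topology"
  by (simp add: continuous_function_group_def)

lemma mult_Ck2_group: "f \<otimes>\<^bsub>Ck2_group X\<^esub> g = (\<lambda>x\<in>topspace X. (f x + g x) mod 2)"
  by (simp add: continuous_function_group_def product_group_def)

lemma one_Ck2_group: "\<one>\<^bsub>Ck2_group X\<^esub> = (\<lambda>x\<in>topspace X. 0)"
  by (simp add: continuous_function_group_def)

context isolated_levels
begin

definition coset :: "('a \<Rightarrow> int) \<Rightarrow> ('a \<Rightarrow> int) set" where
  "coset a = {f \<in> CF. \<forall>x\<in>D. f x = a x}"

text \<open>Addition modulo 2 is subtraction, so this translates the coset of \<open>a\<close> to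
  the functions vanishing on \<open>D\<close> and records their bits at the isolated points, one row
  per level.\<close>

definition chart :: "('a \<Rightarrow> int) \<Rightarrow> ('a \<Rightarrow> int) \<Rightarrow> nat \<Rightarrow> nat \<Rightarrow> int" where
  "chart a f = (\<lambda>n m. (f (e n m) + a (e n m)) mod 2)"

lemma openin_coset: "openin (Ck2 X) (coset a)"
  unfolding openin_Ck2_boxes by (auto simp: coset_def agree_def)

lemma CF_bit: "f \<in> CF \<Longrightarrow> f (e n m) \<in> {0, 1}"
  using continuous_functions_Z2_values[OF _ e_in(1)] by blast

text \<open>A function in the coset coincides with \<open>a\<close> on almost all levels, so almost
  all rows are zero; hence the direct sum instead of the full product.\<close>

lemma chart_in:
  assumes a: "a \<in> CF" and f: "f \<in> coset a"
  shows "chart a f \<in> Cantor_sum"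
proof -
  have fCF: "f \<in> CF" and eq: "\<And>x. x \<in> D \<Longrightarrow> f x = a x" using f by (auto simp: coset_def)
  obtain N where N: "\<And>k m. k \<ge> N \<Longrightarrow> f (e k m) = a (e k m)"
    using CF_eventually_agree[OF a fCF eq] by blast
  have "chart a f n = (\<lambda>_. 0)" if "n \<ge> N" for n
    using N[OF that] by (simp add: chart_def)
  then have "{n. chart a f n \<noteq> (\<lambda>_. 0)} \<subseteq> {..<N}" by (auto simp: not_le[symmetric])
  then have "finite {n. chart a f n \<noteq> (\<lambda>_. 0)}" by (rule finite_subset) simp
  then show ?thesis
    unfolding carrier_direct_power_Cantor using bit_add_closed by (auto simp: chart_def)
qed

lemma chart_agree:
  assumes a: "a \<in> CF" and f: "f \<in> coset a" and g: "g \<in> coset a"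
  shows "agree f k g \<longleftrightarrow> (\<forall>n. \<forall>m<k n. chart a g n m = chart a f n m)"
proof -
  have "f \<in> CF" "g \<in> CF" using f g by (auto simp: coset_def)
  then have "chart a g n m = chart a f n m \<longleftrightarrow> g (e n m) = f (e n m)" for n m
    unfolding chart_def using a by (intro bit_add_cancel(1) CF_bit)
  then show ?thesis using f g by (simp add: agree_def coset_def)
qed

text \<open>Adding \<open>s\<close> to \<open>a\<close> at the isolated points preserves continuity,
  because only finitely many rows of \<open>s\<close> are nonzero and the values on \<open>D\<close>
  are kept.\<close>

lemma chart_surj:
  assumes a: "a \<in> CF" and s: "s \<in> Cantor_sum"
  shows "\<exists>f\<in>coset a. chart a f = s"
proof -
  define i where "i x = (SOME p. x = e (fst p) (snd p))" for x
  have i: "i (e n m) = (n, m)" for n m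
  proof -
    have "e n m = e (fst (i (e n m))) (snd (i (e n m)))"
      unfolding i_def by (rule someI[of _ "(n, m)"]) simp
    then show ?thesis using e_inject by (metis prod.collapse)
  qed
  define f where "f = (\<lambda>x\<in>topspace X. if x \<in> D then a x else (s (fst (i x)) (snd (i x)) + a x) mod 2)"
  have fD: "f x = a x" if "x \<in> D" for x using that D_subset by (auto simp: f_def)
  have fe: "f (e n m) = (s n m + a (e n m)) mod 2" for n m
    using e_in by (simp add: f_def i)
  have "finite {n. s n \<noteq> (\<lambda>_. 0)}" using s by (simp add: carrier_direct_power_Cantor)
  then obtain N where N: "{n. s n \<noteq> (\<lambda>_. 0)} \<subseteq> {..<N}" using finite_nat_bounded by blast
  have tail: "f (e k m) = a (e k m)" if "k \<ge> N" for k m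
  proof -
    have "s k = (\<lambda>_. 0)" using N that by (auto simp: not_le[symmetric])
    then show ?thesis using CF_bit[OF a, of k m] by (auto simp: fe)
  qed
  have "f \<in> CF"
  proof (rule CF_modify[OF a _ _ fD tail])
    show "f \<in> extensional (topspace X)" unfolding f_def by (rule restrict_extensional)
    show "f x \<in> {0, 1}" if "x \<in> topspace X" for x
      using continuous_functions_Z2_values[OF a that] that bit_add_closed by (auto simp: f_def)
  qed
  then have "f \<in> coset a" using fD by (simp add: coset_def)
  moreover have "chart a f = s"
    unfolding chart_def fe
    by (intro ext bit_add_cancel(2)[OF direct_power_Cantor_bit[OF s] CF_bit[OF a] CF_bit[OF a]])
  ultimately show ?thesis by blast
qed

text \<open>Neighbourhoods on both sides are indexed by functions \<open>k\<close>, and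
  \<open>chart_agree\<close> matches them with the same \<open>k\<close>.\<close>

lemma homeomorphic_map_chart:
  assumes a: "a \<in> CF"
  shows "homeomorphic_map (subtopology (Ck2 X) (coset a)) Cantor_sum_topology (chart a)"
proof (rule bijective_open_imp_homeomorphic_map)
  have C: "topspace (subtopology (Ck2 X) (coset a)) = coset a" by (auto simp: coset_def)
  have CCF: "coset a \<subseteq> CF" by (auto simp: coset_def)
  note op = openin_open_subtopology[OF openin_coset]
  show surj: "chart a ` topspace (subtopology (Ck2 X) (coset a)) = topspace Cantor_sum_topology"
    unfolding C topspace_direct_power_Cantor using chart_in[OF a] chart_surj[OF a] by blast
  show "inj_on (chart a) (topspace (subtopology (Ck2 X) (coset a)))"
    unfolding C
  proof (rule inj_onI)
    fix f g assume fg: "f \<in> coset a" "g \<in> coset a" "chart a f = chart a g"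
    have "agree f (\<lambda>n. k) g" for k using fg by (simp add: chart_agree[OF a])
    then have *: "(\<forall>x\<in>D. g x = f x) \<and> (\<forall>n m. g (e n m) = f (e n m))"
      unfolding agree_def using lessI by blast
    have "f x = g x" if "x \<in> topspace X" for x
      using that by (cases rule: point_cases) (use * in auto)
    then show "f = g" using fg(1,2) CCF by (intro continuous_functions_Z2_eqI[of f X g]) auto
  qed
  show "continuous_map (subtopology (Ck2 X) (coset a)) Cantor_sum_topology (chart a)"
    unfolding continuous_map_def
  proof (intro conjI allI impI)
    show "chart a \<in> topspace (subtopology (Ck2 X) (coset a)) \<rightarrow> topspace Cantor_sum_topology"
      using surj by blast
    fix U assume U: "openin Cantor_sum_topology U"
    have "openin (Ck2 X) {f \<in> coset a. chart a f \<in> U}"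
      unfolding openin_Ck2_boxes
    proof (intro conjI ballI)
      show "{f \<in> coset a. chart a f \<in> U} \<subseteq> CF" using CCF by blast
      fix f assume "f \<in> {f \<in> coset a. chart a f \<in> U}"
      then have f: "f \<in> coset a" "chart a f \<in> U" by auto
      obtain k where k: "\<And>t. t \<in> Cantor_sum \<Longrightarrow> \<forall>n. \<forall>m<k n. t n m = chart a f n m \<Longrightarrow> t \<in> U"
        using openin_direct_power_CantorE[OF U f(2)] by blast
      have "g \<in> {f \<in> coset a. chart a f \<in> U}" if g: "g \<in> CF" "agree f k g" for g
      proof -
        have gC: "g \<in> coset a" using g f(1) by (simp add: coset_def agree_def)
        then have "chart a g \<in> U"
          using k[OF chart_in[OF a gC]] g(2) chart_agree[OF a f(1) gC] by simp
        then show ?thesis using gC by simp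
      qed
      then show "\<exists>k. \<forall>g\<in>CF. agree f k g \<longrightarrow> g \<in> {f \<in> coset a. chart a f \<in> U}" by blast
    qed
    then show "openin (subtopology (Ck2 X) (coset a))
        {f \<in> topspace (subtopology (Ck2 X) (coset a)). chart a f \<in> U}"
      unfolding C op by blast
  qed
  show "open_map (subtopology (Ck2 X) (coset a)) Cantor_sum_topology (chart a)"
    unfolding open_map_def op
  proof (intro allI impI)
    fix W assume W: "openin (Ck2 X) W \<and> W \<subseteq> coset a"
    show "openin Cantor_sum_topology (chart a ` W)"
      unfolding openin_direct_power_Cantor
    proof (intro conjI ballI)
      show "chart a ` W \<subseteq> Cantor_sum" using W chart_in[OF a] by blast
      fix s assume "s \<in> chart a ` W"
      then obtain f where f: "f \<in> W" "s = chart a f" by blast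
      have fC: "f \<in> coset a" using f(1) W by blast
      obtain k where k: "\<And>g. g \<in> CF \<Longrightarrow> agree f k g \<Longrightarrow> g \<in> W"
        using W f(1) unfolding openin_Ck2_boxes by meson
      have "t \<in> chart a ` W" if t: "t \<in> Cantor_sum" "\<forall>n. \<forall>m<k n. t n m = s n m" for t
      proof -
        obtain g where g: "g \<in> coset a" "chart a g = t" using chart_surj[OF a t(1)] by blast
        have "agree f k g" using t(2) chart_agree[OF a fC g(1)] unfolding g(2) f(2) by blast
        then have "g \<in> W" using k g(1) CCF by blast
        then show ?thesis using g(2) by blast
      qed
      then show "\<exists>k. \<forall>t\<in>Cantor_sum. (\<forall>n. \<forall>m<k n. t n m = s n m) \<longrightarrow> t \<in> chart a ` W" by blast
    qed
  qed
qed

text \<open>The open subgroup asked for in case (a). It is the kernel of restriction to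
  \<open>D\<close>, so its cosets correspond to the restrictions of continuous functions to
  \<open>D\<close>.\<close>

definition vanishing :: "('a \<Rightarrow> int) set" where
  "vanishing = {f \<in> CF. \<forall>x\<in>D. f x = 0}"

lemma zero_CF: "(\<lambda>x\<in>topspace X. 0) \<in> CF"
  using group.is_monoid[OF group_Ck2_group[of X], THEN monoid.one_closed]
  by (simp only: carrier_Ck2_group one_Ck2_group)

lemma vanishing_eq_coset: "vanishing = coset (\<lambda>x\<in>topspace X. 0)"
  unfolding vanishing_def coset_def using D_subset by auto

lemma subgroup_vanishing: "subgroup vanishing (Ck2_group X)"
proof (rule group.subgroupI[OF group_Ck2_group])
  interpret G: group "Ck2_group X" by (rule group_Ck2_group)
  show "vanishing \<subseteq> carrier (Ck2_group X)" by (auto simp: vanishing_def carrier_Ck2_group)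
  have "(\<lambda>x\<in>topspace X. 0) \<in> vanishing"
    unfolding vanishing_def using zero_CF D_subset by auto
  then show "vanishing \<noteq> {}" by blast
  have bit: "f x = 0 \<or> f x = 1" if "f \<in> vanishing" "x \<in> topspace X" for f x
    using that continuous_functions_Z2_values[of f X x] by (simp add: vanishing_def)
  show "inv\<^bsub>Ck2_group X\<^esub> f \<in> vanishing" if f: "f \<in> vanishing" for f
  proof -
    have "f \<otimes>\<^bsub>Ck2_group X\<^esub> f = \<one>\<^bsub>Ck2_group X\<^esub>"
      unfolding mult_Ck2_group one_Ck2_group by (rule restrict_ext) simp
    then have "inv\<^bsub>Ck2_group X\<^esub> f = f"
      using f by (intro G.inv_equality) (auto simp: vanishing_def carrier_Ck2_group)
    then show ?thesis using f by simp
  qed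
  show "f \<otimes>\<^bsub>Ck2_group X\<^esub> g \<in> vanishing" if "f \<in> vanishing" "g \<in> vanishing" for f g
  proof -
    have "f \<otimes>\<^bsub>Ck2_group X\<^esub> g \<in> CF"
      using G.m_closed[of f g] that by (simp only: carrier_Ck2_group vanishing_def mem_Collect_eq)
    moreover have "(f \<otimes>\<^bsub>Ck2_group X\<^esub> g) x = 0" if "x \<in> D" for x
      using that \<open>f \<in> vanishing\<close> \<open>g \<in> vanishing\<close> D_subset
      by (auto simp: mult_Ck2_group vanishing_def)
    ultimately show ?thesis by (simp add: vanishing_def)
  qed
qed

lemma topologically_isomorphic_vanishing:
  "topologically_isomorphic (Ck2_group X\<lparr>carrier := vanishing\<rparr>) (subtopology (Ck2 X) vanishing)
     (direct_power Cantor_group) Cantor_sum_topology"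
  unfolding topologically_isomorphic_def
proof (intro exI conjI)
  let ?z = "\<lambda>x\<in>topspace X. 0 :: int"
  show hom: "homeomorphic_map (subtopology (Ck2 X) vanishing) Cantor_sum_topology (chart ?z)"
    unfolding vanishing_eq_coset by (rule homeomorphic_map_chart[OF zero_CF])
  have top: "topspace (subtopology (Ck2 X) vanishing) = vanishing" by (auto simp: vanishing_def)
  have bij: "bij_betw (chart ?z) vanishing Cantor_sum"
    using homeomorphic_imp_injective_map[OF hom] homeomorphic_imp_surjective_map[OF hom]
    unfolding top topspace_direct_power_Cantor bij_betw_def by blast
  have "chart ?z (f \<otimes>\<^bsub>Ck2_group X\<^esub> g) = chart ?z f \<otimes>\<^bsub>direct_power Cantor_group\<^esub> chart ?z g"
    for f g
    unfolding mult_direct_power_Cantor mult_Ck2_group chart_def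
    using e_in(1) by (simp add: mod_simps)
  then show "chart ?z \<in> iso (Ck2_group X\<lparr>carrier := vanishing\<rparr>) (direct_power Cantor_group)"
    using bij bij_betwE[OF bij] by (intro isoI homI) auto
qed

text \<open>Cosets are labelled by restrictions to \<open>D\<close>. A label is determined by the
  set where it is 1, a compact open subset of \<open>D\<close>, and second countability leaves only
  countably many of these.\<close>

lemma Ck2_homeomorphic_direct_power:
  assumes "second_countable X"
  shows "Ck2 X homeomorphic_space Cantor_sum_topology"
proof (rule homeomorphic_space_absorb_discrete[OF _ direct_power_Cantor_split])
  let ?q = "\<lambda>f :: 'a \<Rightarrow> int. restrict f D"
  define rep where "rep i = (SOME f. f \<in> CF \<and> ?q f = i)" for i
  have rep: "rep i \<in> CF \<and> ?q (rep i) = i" if "i \<in> ?q ` CF" for i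
    unfolding rep_def by (rule someI_ex[of "\<lambda>f. f \<in> CF \<and> ?q f = i"]) (use that in blast)
  have q_eq: "?q f = ?q g \<longleftrightarrow> (\<forall>x\<in>D. f x = g x)" for f g :: "'a \<Rightarrow> int"
    by (metis restrict_apply' restrict_ext)
  show "Ck2 X homeomorphic_space prod_topology (discrete_topology (?q ` CF)) Cantor_sum_topology"
  proof (rule homeomorphic_space_fibres)
    show "continuous_map (Ck2 X) (discrete_topology (?q ` CF)) ?q"
      unfolding continuous_map_def
    proof (intro conjI allI impI)
      fix U
      have "?q g = ?q f" if "agree f k g" for f g k
        unfolding q_eq using that by (simp add: agree_def)
      then show "openin (Ck2 X) {f \<in> topspace (Ck2 X). ?q f \<in> U}"
        unfolding openin_Ck2_boxes by auto
    qed auto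
    fix i assume "i \<in> ?q ` CF"
    note i = rep[OF this]
    have "{f \<in> topspace (Ck2 X). ?q f = i} = coset (rep i)"
      using i q_eq[of _ "rep i"] by (auto simp: coset_def)
    then show "homeomorphic_map (subtopology (Ck2 X) {f \<in> topspace (Ck2 X). ?q f = i}) Cantor_sum_topology (chart (rep i))"
      using homeomorphic_map_chart[of "rep i"] i by simp
  qed
  show "?q ` CF \<noteq> {}" using zero_CF by blast
  show "countable (?q ` CF)"
  proof (rule countable_image_inj_on[of "\<lambda>i. {x \<in> D. i x = 1}"])
    have sc: "second_countable (subtopology X D)" using assms by (rule second_countable_subtopology)
    have "openin (subtopology X D) {x \<in> D. f x = 1} \<and> compactin (subtopology X D) {x \<in> D. f x = 1}"
      if f: "f \<in> CF" for f
    proof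
      have eq: "{x \<in> D. f x = 1} = D \<inter> {x \<in> topspace X. f x = 1}" using D_subset by blast
      show "openin (subtopology X D) {x \<in> D. f x = 1}"
        unfolding eq using f by (intro openin_subtopology_Int2) (simp add: continuous_functions_Z2_iff)
      have "compactin X {x \<in> D. f x = 1}"
        unfolding eq by (rule compact_Int_closedin[OF compact_D continuous_functions_Z2_closedin[OF f]])
      then show "compactin (subtopology X D) {x \<in> D. f x = 1}" by (auto simp: compactin_subtopology)
    qed
    moreover have "{x \<in> D. ?q f x = 1} = {x \<in> D. f x = 1}" for f by auto
    ultimately have "(\<lambda>i. {x \<in> D. i x = 1}) ` ?q ` CF \<subseteq>
        {U. openin (subtopology X D) U \<and> compactin (subtopology X D) U}"
      by auto
    then show "countable ((\<lambda>i. {x \<in> D. i x = 1}) ` ?q ` CF)"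
      using countable_compact_open[OF sc] by (rule countable_subset)
    show "inj_on (\<lambda>i. {x \<in> D. i x = 1}) (?q ` CF)"
    proof (rule inj_onI)
      fix i j assume "i \<in> ?q ` CF" "j \<in> ?q ` CF" and eq: "{x \<in> D. i x = 1} = {x \<in> D. j x = 1}"
      then obtain f g where f: "f \<in> CF" "i = ?q f" and g: "g \<in> CF" "j = ?q g" by blast
      have "f x = g x" if x: "x \<in> D" for x
      proof -
        have "x \<in> {x \<in> D. ?q f x = 1} \<longleftrightarrow> x \<in> {x \<in> D. ?q g x = 1}"
          using eq unfolding f(2) g(2) by (simp only:)
        then have "f x = 1 \<longleftrightarrow> g x = 1" using x by simp
        then show ?thesis
          using continuous_functions_Z2_values[OF f(1), of x] continuous_functions_Z2_values[OF g(1), of x]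
            x D_subset by auto
      qed
      then show "i = j" unfolding f(2) g(2) q_eq by blast
    qed
  qed
  show "countable {F :: nat set. finite F}" by (rule countable_Collect_finite)
  show "infinite {F :: nat set. finite F}"
  proof
    assume "finite {F :: nat set. finite F}"
    then have "finite ((\<lambda>n::nat. {n}) -` {F. finite F})" by (rule finite_vimageI) (auto intro: injI)
    then show False by simp
  qed
qed

end

section \<open>Existence of levels\<close>

text \<open>A Lebesgue number of the one-element cover \<open>{U}\<close> shows that the
  neighbourhoods of radius 1/(n+1) of the compact derived set eventually lie in
  \<open>U\<close>.\<close>

lemma (in Metric_space) compact_derived_set_thickening:
  assumes D: "compactin mtopology (mtopology derived_set_of M)"
  obtains W :: "nat \<Rightarrow> 'a set" where "\<And>n. openin mtopology (W n)"
    "\<And>n. mtopology derived_set_of M \<subseteq> W n"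
    "\<And>U. openin mtopology U \<Longrightarrow> mtopology derived_set_of M \<subseteq> U \<Longrightarrow> \<exists>n. W n \<subseteq> U"
proof (rule that[of "\<lambda>n. \<Union>y\<in>mtopology derived_set_of M. mball y (1 / Suc n)"])
  let ?D = "mtopology derived_set_of M"
  have DM: "?D \<subseteq> M" using derived_set_of_subset_topspace[of mtopology M] by simp
  show "openin mtopology (\<Union>y\<in>?D. mball y (1 / Suc n))" for n
    by (intro openin_Union) auto
  show "?D \<subseteq> (\<Union>y\<in>?D. mball y (1 / Suc n))" for n
  proof
    fix x assume "x \<in> ?D"
    then show "x \<in> (\<Union>y\<in>?D. mball y (1 / Suc n))"
      by (intro UN_I[of x]) (use DM in auto)
  qed
  fix U assume U: "openin mtopology U" "?D \<subseteq> U"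
  then obtain \<epsilon> where e: "\<epsilon> > 0" "\<And>x. x \<in> ?D \<Longrightarrow> mball x \<epsilon> \<subseteq> U"
    using lebesgue_number[OF D, of "{U}"] by auto
  obtain n where n: "1 / Suc n < \<epsilon>" using nat_approx_posE[OF e(1)] by blast
  have "mball y (1 / Suc n) \<subseteq> U" if "y \<in> ?D" for y
    using e(2)[OF that] mball_subset_concentric[of "1 / Suc n" \<epsilon> y] n by auto
  then show "\<exists>n. (\<Union>y\<in>?D. mball y (1 / Suc n)) \<subseteq> U" by blast
qed

text \<open>Finitely many members of a cover contain the derived set, hence some \<open>W n\<close>,
  and finitely many points of \<open>V\<close> remain. So \<open>V\<close> is compact, and outside
  it all points are isolated. Contraposed, this provides infinite levels.\<close>

lemma locally_compact_space_if_finite_differences: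
  assumes D: "compactin X (X derived_set_of topspace X)"
    and V: "openin X V" "X derived_set_of topspace X \<subseteq> V"
    and base: "\<And>U. openin X U \<Longrightarrow> X derived_set_of topspace X \<subseteq> U \<Longrightarrow> \<exists>n. W n \<subseteq> U"
    and fin: "\<And>n. finite (V - W n)"
  shows "locally_compact_space X"
proof -
  have VX: "V \<subseteq> topspace X" using V(1) by (rule openin_subset)
  have "compactin X V"
    unfolding compactin_def
  proof (intro conjI allI impI VX)
    fix \<U> assume \<U>: "Ball \<U> (openin X) \<and> V \<subseteq> \<Union>\<U>"
    then have "X derived_set_of topspace X \<subseteq> \<Union>\<U>" using V(2) by (meson order_trans)
    then obtain F where F: "finite F" "F \<subseteq> \<U>" "X derived_set_of topspace X \<subseteq> \<Union>F"
      using D \<U> unfolding compactin_def by meson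
    then have "openin X (\<Union>F)" using \<U> by (intro openin_Union) auto
    then obtain n where n: "W n \<subseteq> \<Union>F" using base F(3) by blast
    have "V - W n \<subseteq> \<Union>\<U>" using \<U> by (meson Diff_subset order_trans)
    then obtain F' where F': "finite F'" "F' \<subseteq> \<U>" "V - W n \<subseteq> \<Union>F'"
      using finite_subset_Union[OF fin[of n], of \<U>] by metis
    have "V \<subseteq> \<Union>(F \<union> F')" using n F'(3) by blast
    with F F' show "\<exists>\<F>. finite \<F> \<and> \<F> \<subseteq> \<U> \<and> V \<subseteq> \<Union>\<F>"
      by (intro exI[of _ "F \<union> F'"]) simp
  qed
  show ?thesis
    unfolding locally_compact_space_def
  proof
    fix x assume x: "x \<in> topspace X"
    show "\<exists>U K. openin X U \<and> compactin X K \<and> x \<in> U \<and> U \<subseteq> K"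
    proof (cases "x \<in> V")
      case True
      then show ?thesis using V(1) \<open>compactin X V\<close> by blast
    next
      case False
      then have "openin X {x}" using x V(2) by (intro openin_isolated_point) auto
      then show ?thesis using x by (intro exI[of _ "{x}"]) simp
    qed
  qed
qed

lemma countable_isolated_points:
  assumes "separable_space X"
  shows "countable (topspace X - X derived_set_of topspace X)"
proof -
  obtain C where C: "countable C" "X closure_of C = topspace X"
    using assms by (auto simp: separable_space_def)
  have "topspace X - X derived_set_of topspace X \<subseteq> C"
  proof
    fix x assume x: "x \<in> topspace X - X derived_set_of topspace X"
    then have "openin X {x}" by (intro openin_isolated_point) auto
    moreover have "x \<in> X closure_of C" using x C(2) by simp
    ultimately show "x \<in> C" unfolding in_closure_of by (metis singletonD singletonI)
  qed
  then show ?thesis using C(1) countable_subset by blast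
qed

text \<open>Since \<open>M\<close> is not locally compact, a decreasing neighbourhood base of the derived set can be
  chosen with infinite successive differences; these are the levels.\<close>

lemma (in Metric_space) isolated_levels_exist:
  assumes sep: "separable_space mtopology" and D: "compactin mtopology (mtopology derived_set_of M)"
    and nlc: "\<not> locally_compact_space mtopology"
  shows "\<exists>e. isolated_levels mtopology (mtopology derived_set_of M) e"
proof -
  let ?D = "mtopology derived_set_of M"
  have DM: "?D \<subseteq> M" using derived_set_of_subset_topspace[of mtopology M] by simp
  obtain W :: "nat \<Rightarrow> 'a set" where W: "\<And>n. openin mtopology (W n)" "\<And>n. ?D \<subseteq> W n"
    "\<And>U. openin mtopology U \<Longrightarrow> ?D \<subseteq> U \<Longrightarrow> \<exists>n. W n \<subseteq> U"
    using compact_derived_set_thickening[OF D] by metis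
  \<comment> \<open>Inclusion in the earlier \<open>W j\<close> makes the sequence a neighbourhood
    base of the derived set, and starting with all of \<open>M\<close> lets every isolated point
    fall into some level.\<close>
  let ?P = "\<lambda>k V. openin mtopology V \<and> ?D \<subseteq> V \<and> (k = 0 \<longrightarrow> V = M) \<and> (\<forall>j<k. V \<subseteq> W j)"
  let ?Q = "\<lambda>k V V'. V' \<subseteq> V \<and> infinite (V - V')"
  have "\<exists>V. ?P 0 V" using DM openin_topspace[of mtopology] by (intro exI[of _ M]) simp
  moreover have "\<exists>V'. ?P (Suc k) V' \<and> ?Q k V V'" if V: "?P k V" for k V
  proof -
    have "\<exists>n. infinite (V - W n)"
    proof (rule ccontr)
      assume "\<not> ?thesis"
      then have "locally_compact_space mtopology"
        using locally_compact_space_if_finite_differences[of mtopology V W] D V W(3) by simp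
      then show False using nlc by simp
    qed
    then obtain n where n: "infinite (V - W n)" by blast
    have "infinite (V - (V \<inter> W n \<inter> W k))"
      by (rule infinite_super[OF _ n]) blast
    moreover have "V \<inter> W n \<inter> W k \<subseteq> W j" if "j < Suc k" for j
    proof (cases "j = k")
      case False
      then have "V \<subseteq> W j" using V that by simp
      then show ?thesis by blast
    qed simp
    moreover have "openin mtopology (V \<inter> W n \<inter> W k)" using V W(1) by (simp add: openin_Int)
    moreover have "?D \<subseteq> V \<inter> W n \<inter> W k" using V W(2) by simp
    ultimately show ?thesis by (intro exI[of _ "V \<inter> W n \<inter> W k"]) auto
  qed
  ultimately have "\<exists>V. \<forall>k. ?P k (V k) \<and> ?Q k (V k) (V (Suc k))" by (rule dependent_nat_choice)
  then obtain V where PQ: "\<And>k. ?P k (V k) \<and> ?Q k (V k) (V (Suc k))" by auto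
  have V: "openin mtopology (V k)" "?D \<subseteq> V k" "V (Suc k) \<subseteq> V k" "infinite (V k - V (Suc k))"
    "V 0 = M" "V (Suc k) \<subseteq> W k" for k
    using PQ[of k] PQ[of 0] PQ[of "Suc k"] by simp_all
  have V_mono: "V j \<subseteq> V k" if "k \<le> j" for j k
    by (rule lift_Suc_antimono_le[of V, OF V(3) that])
  have VM: "V k \<subseteq> M" for k using openin_subset[OF V(1)] by simp
  have sub: "V n - V (Suc n) \<subseteq> topspace mtopology - ?D" for n
    using VM V(2) by fastforce
  have cnt: "countable (V n - V (Suc n))" for n
    using countable_isolated_points[OF sep] sub by (metis countable_subset topspace_mtopology)
  define e where "e n = from_nat_into (V n - V (Suc n))" for n
  have bij: "bij_betw (e n) UNIV (V n - V (Suc n))" for n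
    unfolding e_def by (rule bij_betw_from_nat_into[OF cnt V(4)])
  have e_level: "e n m \<in> V n" "e n m \<notin> V (Suc n)" for n m
    using bij_betwE[OF bij[of n]] by auto
  have level: "\<exists>m. x = e n m" if "x \<in> V n" "x \<notin> V (Suc n)" for x n
    using that bij_betw_imp_surj_on[OF bij[of n]] by (metis DiffI imageE)
  have level_of: "\<exists>n m. x = e n m" if x: "x \<in> M" "x \<notin> ?D" for x
  proof -
    have "closedin mtopology {x}"
      using x(1) by (intro closedin_Hausdorff_singleton Hausdorff_space_mtopology) simp
    then have "openin mtopology (M - {x})"
      using openin_diff[OF openin_topspace[of mtopology]] by simp
    moreover have "?D \<subseteq> M - {x}" using DM x(2) by blast
    ultimately obtain n where "W n \<subseteq> M - {x}" using W(3) by blast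
    then have "x \<notin> V (Suc n)" using V(6)[of n] by blast
    then have ex: "\<exists>k. x \<notin> V k" by blast
    \<comment> \<open>The level of \<open>x\<close> is \<open>k - 1\<close>, the index just before
      \<open>x\<close> is first omitted; \<open>k\<close> is positive because
      \<open>V 0 = M\<close>.\<close>
    define k where "k = (LEAST k. x \<notin> V k)"
    have k: "x \<notin> V k" unfolding k_def by (rule LeastI_ex[OF ex])
    then have "k \<noteq> 0" using x(1) V(5) by metis
    then obtain n where n: "k = Suc n" using not0_implies_Suc by blast
    have "x \<in> V n" using not_less_Least[of n "\<lambda>k. x \<notin> V k"] n unfolding k_def[symmetric] by simp
    then show ?thesis using level k n by blast
  qed
  have disj: "k \<le> n" if "e n m \<in> V k" for n m k
    using that e_level(2)[of n m] V_mono[of "Suc n" k] by (meson not_less_eq_eq subsetD)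
  have "isolated_levels mtopology ?D e"
  proof
    show "?D = mtopology derived_set_of topspace mtopology" by simp
    show "compactin mtopology ?D" by (rule D)
    fix n m n' m' assume eq: "e n m = e n' m'"
    then have "n = n'" using disj[of n m n'] disj[of n' m' n] e_level(1) by (metis le_antisym)
    with eq show "n = n' \<and> m = m'"
      using bij_betw_imp_inj_on[OF bij[of n]] by (auto dest: injD)
  next
    fix x
    have "e n m \<in> M - ?D" for n m using sub[of n] e_level[of n m] by auto
    then show "x \<in> topspace mtopology - ?D \<longleftrightarrow> (\<exists>n m. x = e n m)"
      using level_of by auto
  next
    fix n
    have "?D \<union> {e k m |k m. n \<le> k} = V n"
    proof
      have "e k m \<in> V n" if "n \<le> k" for k m
        using e_level(1)[of k m] V_mono[OF that] by blast
      then show "?D \<union> {e k m |k m. n \<le> k} \<subseteq> V n" using V(2)[of n] by blast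
      show "V n \<subseteq> ?D \<union> {e k m |k m. n \<le> k}"
      proof
        fix x assume x: "x \<in> V n"
        show "x \<in> ?D \<union> {e k m |k m. n \<le> k}"
        proof (cases "x \<in> ?D")
          case False
          then obtain k m where "x = e k m" using level_of[of x] x VM[of n] by blast
          then show ?thesis using disj[of k m n] x by blast
        qed simp
      qed
    qed
    then show "openin mtopology (?D \<union> {e k m |k m. n \<le> k})" using V(1) by simp
  next
    fix U assume "openin mtopology U" "?D \<subseteq> U"
    then obtain n where n: "W n \<subseteq> U" using W(3) by blast
    have "e k m \<in> U" if "k \<ge> Suc n" for k m
      using e_level(1)[of k m] V_mono[OF that] V(6)[of n] n by blast
    then show "\<exists>n. \<forall>k\<ge>n. \<forall>m. e k m \<in> U" by blast
  qed
  then show ?thesis by blast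
qed

theorem theorem3p5:
  fixes M :: "'a set" and d :: "'a \<Rightarrow> 'a \<Rightarrow> real" and X :: "'a topology"
  assumes "Metric_space M d"
    and "X = Metric_space.mtopology M d"
    and "zero_dimensional_space X"
  shows "(sequential_space (Ck2 X) \<longleftrightarrow>
            Polish_space X \<and>
            ((\<not> locally_compact_space X \<and> compactin X (X derived_set_of topspace X))
             \<or> locally_compact_space X))
       \<and> (Polish_space X \<and> \<not> locally_compact_space X \<and> compactin X (X derived_set_of topspace X) \<longrightarrow>
            (\<exists>H. subgroup H (Ck2_group X) \<and> openin (Ck2 X) H \<and>
                 topologically_isomorphic
                   (Ck2_group X \<lparr>carrier := H\<rparr>) (subtopology (Ck2 X) H)
                   (direct_power Cantor_group) (direct_power_topology Cantor_group Cantor_topology))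
            \<and> Ck2 X homeomorphic_space direct_power_topology Cantor_group Cantor_topology)
       \<and> (Polish_space X \<and> locally_compact_space X \<longrightarrow> Polish_space (Ck2 X))"
proof -
  interpret Metric_space M d by (rule assms(1))
  note X = assms(2) and zd = assms(3)
  have topX: "topspace X = M" by (simp add: X)
  have H: "Hausdorff_space X" by (simp add: X Hausdorff_space_mtopology)
  have sc: "second_countable X" if "Polish_space X"
    using that separable_space_imp_second_countable by (simp add: Polish_space_def X)
  have lc_Polish: "Polish_space (Ck2 X)" if "Polish_space X" "locally_compact_space X"
    using Polish_space_Ck2[OF zd that(2) sc[OF that(1)] H] .
  have levels: "\<exists>e. isolated_levels X (X derived_set_of topspace X) e"
    if "Polish_space X" "\<not> locally_compact_space X" "compactin X (X derived_set_of topspace X)"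
    using isolated_levels_exist that by (simp add: Polish_space_def X)
  \<comment> \<open>By cases on local compactness, the disjunction of (a) and (b) is the simpler one
    used here.\<close>
  have forward: "Polish_space X \<and>
      (compactin X (X derived_set_of topspace X) \<or> locally_compact_space X)"
    if seq: "sequential_space (Ck2 X)"
  proof
    have sep: "separable_space X"
      using sequential_Ck2_imp_Lindelof_space[OF zd seq] Lindelof_space_imp_separable_space
      by (simp add: X)
    show cpt_lc: "compactin X (X derived_set_of topspace X) \<or> locally_compact_space X"
      using sequential_Ck2_imp_compact_or_locally_compact zd seq by (simp add: X)
    then have "completely_metrizable_space X"
      using compact_derived_set_imp_completely_metrizable_space
        locally_compact_imp_completely_metrizable_space by (auto simp: X)
    with sep show "Polish_space X" by (simp add: Polish_space_def)
  qed
  have backward: "sequential_space (Ck2 X)"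
    if P: "Polish_space X" and c: "compactin X (X derived_set_of topspace X) \<or> locally_compact_space X"
  proof (cases "locally_compact_space X")
    case True
    then have "completely_metrizable_space (Ck2 X)"
      using lc_Polish[OF P] by (simp add: Polish_space_def)
    then show ?thesis
      by (intro first_countable_imp_sequential_space metrizable_imp_first_countable
          completely_metrizable_imp_metrizable_space)
  next
    case False
    then obtain e where "isolated_levels X (X derived_set_of topspace X) e"
      using levels[OF P] c by blast
    then show ?thesis by (rule isolated_levels.sequential_space_Ck2)
  qed
  have iso: "(\<exists>H. subgroup H (Ck2_group X) \<and> openin (Ck2 X) H \<and>
        topologically_isomorphic (Ck2_group X \<lparr>carrier := H\<rparr>) (subtopology (Ck2 X) H)
          (direct_power Cantor_group) Cantor_sum_topology) \<and> Ck2 X homeomorphic_space Cantor_sum_topology"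
    if P: "Polish_space X" and nlc: "\<not> locally_compact_space X"
      and c: "compactin X (X derived_set_of topspace X)"
  proof -
    obtain e where "isolated_levels X (X derived_set_of topspace X) e"
      using levels[OF P nlc c] by blast
    then interpret L: isolated_levels X "X derived_set_of topspace X" e .
    have "openin (Ck2 X) L.vanishing"
      unfolding L.vanishing_eq_coset by (rule L.openin_coset)
    then show ?thesis
      using L.subgroup_vanishing L.topologically_isomorphic_vanishing
        L.Ck2_homeomorphic_direct_power[OF sc[OF P]] by blast
  qed
  show ?thesis using forward backward iso lc_Polish by blast
qed

end
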